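(* Let $n$ be a positive integer, let $q$ be a prime power, let $G=\operatorname{PSL}_n(q)$, and let $r$ be a prime divisor of $\gcd(n,q-1)$. Let $\rho$ be the natural permutation representation of $G$ on the points of the projective space $\mathbb{P}^{n-1}(q)$. Then the permutation wreath product $\mathbb{Z}_r\wr_\rho G$ contains a subgroup isomorphic to the nonsplit central extension $\mathbb{Z}_r.G$ if and only if $r$ does not divide $(q-1)/\gcd(n,q-1)$.
   Context: $\mathbb{Z}_r$ denotes the cyclic group of order $r$. A central extension $\mathbb{Z}_r.G$ is a group $B$ with a short exact sequence $1\to \mathbb{Z}_r\to B\to G\to 1$ in which the image of $\mathbb{Z}_r$ lies in the center of $B$; it is nonsplit if the sequence does not split. For $G=\operatorname{PSL}_n(q)$ and $r$ a prime divisor of $\gcd(n,q-1)$, the nonsplit central extension $\mathbb{Z}_r.G$ is unique up to isomorphism and is a quotient of $\operatorname{SL}_n(q)$, namely $\operatorname{SL}_n(q)/Z'$, where $Z'$ is the unique subgroup of index $r$ in the (cyclic) center of $\operatorname{SL}_n(q)$. The points of $\mathbb{P}^{n-1}(q)$ are the one-dimensional subspaces of $\mathbb{F}_q^n$. The permutation wreath product $\mathbb{Z}_r\wr_\rho G$ is the semidirect product $V\rtimes G$, where $V$ is the permutation $\mathbb{F}_rG$-module with basis the set of points of $\mathbb{P}^{n-1}(q)$, permuted by $G$ via $\rho$. *)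

theory Defs
  imports
    "HOL-Analysis.Analysis"
    "HOL-Algebra.Group_Action"
    "HOL-Algebra.Product_Groups"
    "HOL-Algebra.Multiplicative_Group"
    "HOL-Number_Theory.Residues"
begin

section \<open>Central extensions\<close>

definition group_center :: "('g, 'm) monoid_scheme \<Rightarrow> 'g set" where
  "group_center G = {z \<in> carrier G. \<forall>g \<in> carrier G. g \<otimes>\<^bsub>G\<^esub> z = z \<otimes>\<^bsub>G\<^esub> g}"

definition central_extension ::
  "('z, 'k) monoid_scheme \<Rightarrow> ('b, 'l) monoid_scheme \<Rightarrow> ('g, 'm) monoid_scheme
    \<Rightarrow> ('z \<Rightarrow> 'b) \<Rightarrow> ('b \<Rightarrow> 'g) \<Rightarrow> bool" where
  "central_extension Z B G \<iota> \<pi> \<longleftrightarrow>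
     group Z \<and> group B \<and> group G \<and> \<iota> \<in> mon Z B \<and> \<pi> \<in> epi B G \<and>
     kernel B G \<pi> = \<iota> ` carrier Z \<and> \<iota> ` carrier Z \<subseteq> group_center B"

definition nonsplit_central_extension ::
  "nat \<Rightarrow> ('b, 'l) monoid_scheme \<Rightarrow> ('g, 'm) monoid_scheme \<Rightarrow> bool" where
  "nonsplit_central_extension r B G \<longleftrightarrow>
     (\<exists>\<iota> \<pi>. central_extension (integer_mod_group r) B G \<iota> \<pi> \<and>
            \<not> (\<exists>\<sigma> \<in> hom G B. \<forall>g \<in> carrier G. \<pi> (\<sigma> g) = g))"

section \<open>Permutation wreath products\<close>

definition semidirect_product ::
  "('v, 'k) monoid_scheme \<Rightarrow> ('g, 'm) monoid_scheme \<Rightarrow> ('g \<Rightarrow> 'v \<Rightarrow> 'v) \<Rightarrow> ('v \<times> 'g) monoid" where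
  "semidirect_product V G \<theta> =
     \<lparr>carrier = carrier V \<times> carrier G,
      monoid.mult = (\<lambda>(v, g) (w, h). (v \<otimes>\<^bsub>V\<^esub> \<theta> g w, g \<otimes>\<^bsub>G\<^esub> h)),
      one = (\<one>\<^bsub>V\<^esub>, \<one>\<^bsub>G\<^esub>)\<rparr>"

text \<open>
  The basis vector at \<open>\<omega>\<close> is the indicator function of \<open>\<omega>\<close>; \<open>g\<close> has to move it to the one
  at \<open>\<rho> g \<omega>\<close>, which is why the argument is translated by the inverse of \<open>g\<close>.
\<close>

definition permutation_module_action ::
  "('g, 'm) monoid_scheme \<Rightarrow> 'w set \<Rightarrow> ('g \<Rightarrow> 'w \<Rightarrow> 'w) \<Rightarrow> 'g \<Rightarrow> ('w \<Rightarrow> 'a) \<Rightarrow> 'w \<Rightarrow> 'a" where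
  "permutation_module_action G \<Omega> \<rho> g v = (\<lambda>\<omega> \<in> \<Omega>. v (\<rho> (inv\<^bsub>G\<^esub> g) \<omega>))"

definition permutation_wreath_product ::
  "('a, 'k) monoid_scheme \<Rightarrow> ('g, 'm) monoid_scheme \<Rightarrow> 'w set \<Rightarrow> ('g \<Rightarrow> 'w \<Rightarrow> 'w)
    \<Rightarrow> (('w \<Rightarrow> 'a) \<times> 'g) monoid" where
  "permutation_wreath_product A G \<Omega> \<rho> =
     semidirect_product (product_group \<Omega> (\<lambda>_. A)) G (permutation_module_action G \<Omega> \<rho>)"

section \<open>Projective special linear groups and their natural action\<close>

definition SL :: "('a::field ^ 'n ^ 'n) monoid" where
  "SL = \<lparr>carrier = {A. det A = 1}, monoid.mult = (**), one = mat 1\<rparr>"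

definition PSL :: "('a::field ^ 'n ^ 'n) set monoid" where
  "PSL = SL Mod group_center SL"

definition proj_points :: "('a::field ^ 'n) set set" where
  "proj_points = {W. vec.subspace W \<and> vec.dim W = 1}"

text \<open>
  The center of \<^term>\<open>SL\<close> consists of scalar matrices, so all matrices in an element \<open>C\<close> of
  \<^term>\<open>PSL\<close> map a point \<open>W\<close> to the same point, which is also the union of these images.
\<close>

definition proj_action ::
  "('a::field ^ 'n ^ 'n) set \<Rightarrow> ('a ^ 'n) set \<Rightarrow> ('a ^ 'n) set" where
  "proj_action C = (\<lambda>W \<in> proj_points. \<Union>A \<in> C. (\<lambda>v. A *v v) ` W)"

section \<open>Well-definedness\<close>

text \<open>
  The constructions above yield groups, \<^const>\<open>proj_action\<close> is an action, and the quotient of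
  \<^term>\<open>SL\<close> by a subgroup of prime index \<open>r\<close> in its center is a nonsplit central extension
  of \<^term>\<open>PSL\<close> by the cyclic group of order \<open>r\<close> whenever \<open>r\<close> divides \<open>gcd n (q - 1)\<close>.
\<close>

lemma SL_simps [simp]:
  "carrier SL = {A. det A = 1}" "A \<otimes>\<^bsub>SL\<^esub> B = A ** B" "\<one>\<^bsub>SL\<^esub> = mat 1"
  by (simp_all add: SL_def)

lemma group_SL: "group (SL :: ('a::field ^ 'n ^ 'n) monoid)"
proof (rule groupI)
  fix A :: "'a ^ 'n ^ 'n" assume "A \<in> carrier SL"
  then have "invertible A" by (simp add: invertible_det_nz)
  then obtain B where B: "B ** A = mat 1" unfolding invertible_def by blast
  then have "det B * det A = 1" by (metis det_I det_mul)
  with B \<open>A \<in> carrier SL\<close> show "\<exists>B\<in>carrier SL. B \<otimes>\<^bsub>SL\<^esub> A = \<one>\<^bsub>SL\<^esub>" by auto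
qed (auto simp: det_mul matrix_mul_assoc)

lemma group_centerD:
  assumes "z \<in> group_center G"
  shows "z \<in> carrier G" "g \<in> carrier G \<Longrightarrow> g \<otimes>\<^bsub>G\<^esub> z = z \<otimes>\<^bsub>G\<^esub> g"
  using assms unfolding group_center_def by blast+

lemma group_centerI:
  "z \<in> carrier G \<Longrightarrow> (\<And>g. g \<in> carrier G \<Longrightarrow> g \<otimes>\<^bsub>G\<^esub> z = z \<otimes>\<^bsub>G\<^esub> g) \<Longrightarrow> z \<in> group_center G"
  unfolding group_center_def by blast

lemma (in group) subgroup_group_center: "subgroup (group_center G) G"
proof
  show "group_center G \<subseteq> carrier G" by (auto simp: group_center_def)
  show "\<one> \<in> group_center G" by (simp add: group_center_def)
next
  fix x y assume xy: "x \<in> group_center G" "y \<in> group_center G"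
  have "g \<otimes> (x \<otimes> y) = x \<otimes> y \<otimes> g" if g: "g \<in> carrier G" for g
  proof -
    have c: "x \<in> carrier G" "y \<in> carrier G" "g \<otimes> x = x \<otimes> g" "g \<otimes> y = y \<otimes> g"
      by (fact group_centerD[OF xy(1)] group_centerD[OF xy(2)] group_centerD(2)[OF xy(1) g] group_centerD(2)[OF xy(2) g])+
    have "g \<otimes> (x \<otimes> y) = g \<otimes> x \<otimes> y" using c(1,2) g by (simp only: m_assoc)
    also have "\<dots> = x \<otimes> (g \<otimes> y)" using c(1,2) g by (simp only: c(3) m_assoc)
    also have "\<dots> = x \<otimes> y \<otimes> g" using c(1,2) g by (simp only: c(4) m_assoc)
    finally show ?thesis .
  qed
  then show "x \<otimes> y \<in> group_center G"
    using group_centerD(1)[OF xy(1)] group_centerD(1)[OF xy(2)] by (intro group_centerI) auto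
next
  fix x assume x: "x \<in> group_center G"
  have "g \<otimes> inv x = inv x \<otimes> g" if g: "g \<in> carrier G" for g
  proof -
    have c: "x \<in> carrier G" "g \<otimes> x = x \<otimes> g"
      using group_centerD[OF x] g by auto
    have "x \<otimes> (g \<otimes> inv x) = g \<otimes> x \<otimes> inv x" using c(1) g by (simp only: c(2) m_assoc inv_closed)
    also have "\<dots> = g" using c(1) g by (simp add: m_assoc)
    finally show ?thesis using c(1) g by (metis inv_closed inv_solve_left m_closed)
  qed
  then show "inv x \<in> group_center G"
    using group_centerD(1)[OF x] by (intro group_centerI) auto
qed

lemma (in group) normal_of_le_center:
  assumes "subgroup N G" "N \<subseteq> group_center G" shows "N \<lhd> G"
proof (rule normal_invI[OF assms(1)])
  fix x h assume "x \<in> carrier G" "h \<in> N"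
  moreover have "h \<in> carrier G" "x \<otimes> h = h \<otimes> x"
    using assms(2) calculation by (auto simp: group_center_def)
  ultimately show "x \<otimes> h \<otimes> inv x \<in> N" by (simp add: m_assoc)
qed

lemma group_PSL: "group (PSL :: ('a::field ^ 'n ^ 'n) set monoid)"
  unfolding PSL_def
  by (intro normal.factorgroup_is_group group.normal_of_le_center group.subgroup_group_center group_SL) auto

lemma proj_points_iff:
  "W \<in> proj_points \<longleftrightarrow> (\<exists>v. v \<noteq> 0 \<and> W = vec.span {v :: 'a::field ^ 'n})"
proof
  assume "W \<in> proj_points"
  then have W: "vec.subspace W" "vec.dim W = 1" by (auto simp: proj_points_def)
  obtain B where B: "B \<subseteq> W" "vec.independent B" "W \<subseteq> vec.span B" "card B = 1"
    using vec.basis_exists[of W] W(2) by metis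
  then obtain v where "B = {v}" by (auto simp: card_1_singleton_iff)
  have "v \<noteq> 0" using B(2) \<open>B = {v}\<close> vec.dependent_zero[of B] by auto
  moreover have "vec.span B \<subseteq> W" using B(1) W(1) by (rule vec.span_minimal)
  then have "W = vec.span {v}" using B(3) \<open>B = {v}\<close> by auto
  ultimately show "\<exists>v. v \<noteq> 0 \<and> W = vec.span {v}" by blast
next
  assume "\<exists>v. v \<noteq> 0 \<and> W = vec.span {v}"
  then obtain v where v: "v \<noteq> 0" "W = vec.span {v}" by blast
  then have "vec.independent {v}" by (simp add: vec.independent_insert)
  then have "vec.dim {v} = 1" by (simp add: vec.dim_eq_card_independent)
  then show "W \<in> proj_points"
    using v(2) by (simp add: proj_points_def vec.subspace_span vec.dim_span)
qed

lemma image_proj_point: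
  assumes "W \<in> proj_points" "det A = 1"
  shows "(\<lambda>v. A *v v) ` W \<in> proj_points"
proof -
  from assms(1) obtain v where v: "v \<noteq> 0" "W = vec.span {v}" by (auto simp: proj_points_iff)
  have "invertible A" using assms(2) by (simp add: invertible_det_nz)
  then have "A *v v \<noteq> 0" using v(1)
    by (metis invertible_def matrix_vector_mul_assoc matrix_vector_mul_lid matrix_vector_mult_0_right)
  moreover have "(\<lambda>v. A *v v) ` W = vec.span {A *v v}"
    using vec.linear_span_image[OF matrix_vector_mul_linear_gen, of A "{v}"] v(2) by simp
  ultimately show ?thesis by (auto simp: proj_points_iff)
qed

subsection \<open>Transvections and the center\<close>

definition transvection :: "'n \<Rightarrow> 'n \<Rightarrow> 'a \<Rightarrow> 'a::field ^ 'n ^ 'n" where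
  "transvection i j t = (\<chi> a b. (if a = b then 1 else 0) + (if a = i \<and> b = j then t else 0))"

lemma det_transvection: "i \<noteq> j \<Longrightarrow> det (transvection i j t) = 1"
proof -
  assume "i \<noteq> j"
  moreover have "transvection i j t =
     (\<chi> k. if k = i then row i (mat 1) + t *s row j (mat 1) else row k (mat 1))"
    by (auto simp: transvection_def vec_eq_iff row_def mat_def)
  ultimately show ?thesis using det_row_operation[of i j "mat 1" t] by (simp add: det_I)
qed

lemma transvection_mult:
  "transvection i j t ** A = (\<chi> a b. A $ a $ b + (if a = i then t * A $ j $ b else 0))"
  "A ** transvection i j t = (\<chi> a b. A $ a $ b + (if b = j then A $ a $ i * t else 0))"
proof -
  have 1: "(\<Sum>k\<in>UNIV. ((if a = k then 1 else 0) + (if a = i \<and> k = j then t else 0)) * A $ k $ b)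
      = A $ a $ b + (if a = i then t * A $ j $ b else 0)" for a b
    by (cases "a = i") (simp_all add: distrib_right sum.distrib if_distrib[of "\<lambda>x. x * _"] cong: if_cong)
  have 2: "(\<Sum>k\<in>UNIV. A $ a $ k * ((if k = b then 1 else 0) + (if k = i \<and> b = j then t else 0)))
      = A $ a $ b + (if b = j then A $ a $ i * t else 0)" for a b
    by (cases "b = j") (simp_all add: distrib_left sum.distrib if_distrib[of "\<lambda>x. _ * x"] cong: if_cong)
  show "transvection i j t ** A = (\<chi> a b. A $ a $ b + (if a = i then t * A $ j $ b else 0))"
    by (simp add: transvection_def matrix_matrix_mult_def vec_eq_iff 1)
  show "A ** transvection i j t = (\<chi> a b. A $ a $ b + (if b = j then A $ a $ i * t else 0))"
    by (simp add: transvection_def matrix_matrix_mult_def vec_eq_iff 2)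
qed

lemma center_SL_scalar:
  assumes "z \<in> group_center (SL :: ('a::field ^ 'n ^ 'n) monoid)"
  obtains c where "z = mat c" "c ^ CARD('n) = 1"
proof -
  have z: "det z = 1" and comm: "\<And>A. det A = 1 \<Longrightarrow> A ** z = z ** A"
    using assms by (auto simp: group_center_def)
  have eq: "(if a = i then z $ j $ b else 0) = (if b = j then z $ a $ i else 0)" if "i \<noteq> j" for a b i j
  proof -
    have "transvection i j 1 ** z = z ** transvection i j 1"
      using that by (simp add: comm det_transvection)
    then have "(transvection i j 1 ** z) $ a $ b = (z ** transvection i j 1) $ a $ b" by simp
    then show ?thesis by (simp add: transvection_mult split: if_splits)
  qed
  fix k0 :: 'n
  define c where "c = z $ k0 $ k0"
  have off: "z $ a $ i = 0" if "a \<noteq> i" for a i using eq[of i a a a] that eq[of a i i i] by auto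
  have dg: "z $ a $ a = c" for a using eq[of a k0 a k0] unfolding c_def by (cases "a = k0") auto
  have zc: "z = mat c" by (auto simp: vec_eq_iff mat_def off dg)
  moreover have "det z = c ^ CARD('n)"
    by (subst det_diagonal) (auto simp: zc mat_def)
  ultimately show thesis using that z by metis
qed

subsection \<open>The projective action and the wreath product\<close>

lemma proj_action_coset:
  assumes A: "det A = 1" and W: "W \<in> proj_points"
  shows "proj_action (group_center SL #>\<^bsub>SL\<^esub> A) W = (\<lambda>v. (A :: 'a::field ^ 'n ^ 'n) *v v) ` W"
proof -
  interpret SL: group "SL :: ('a ^ 'n ^ 'n) monoid" by (rule group_SL)
  have sub: "(\<lambda>v. (z ** A) *v v) ` W \<subseteq> (\<lambda>v. A *v v) ` W" if z: "z \<in> group_center SL" for z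
  proof -
    obtain c where c: "z = mat c" using center_SL_scalar[OF z] by blast
    have "mat c *v u = c *s u" for u :: "'a ^ 'n"
      by (simp add: vec_eq_iff matrix_vector_mult_def mat_def if_distrib[of "\<lambda>x. x * _"] cong: if_cong)
    then have "(z ** A) *v v = A *v (c *s v)" for v
      by (simp add: c vector_scalar_commute flip: matrix_vector_mul_assoc)
    moreover have "c *s v \<in> W" if "v \<in> W" for v
      using W that by (auto simp: proj_points_def vec.subspace_scale)
    ultimately show ?thesis by auto
  qed
  have "mat 1 \<in> group_center (SL :: ('a ^ 'n ^ 'n) monoid)"
    using subgroup.one_closed[OF SL.subgroup_group_center] by simp
  then have "A \<in> group_center SL #>\<^bsub>SL\<^esub> A" by (force simp: r_coset_def)
  with sub show ?thesis
    using W by (auto simp: proj_action_def r_coset_def)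
qed

theorem group_action_proj:
  "group_action (PSL :: ('a::field ^ 'n ^ 'n) set monoid) proj_points proj_action"
proof -
  let ?S = "SL :: ('a ^ 'n ^ 'n) monoid" and ?Z = "group_center (SL :: ('a ^ 'n ^ 'n) monoid)"
  interpret SL: group ?S by (rule group_SL)
  interpret N: normal ?Z ?S
    by (intro SL.normal_of_le_center SL.subgroup_group_center subset_refl)
  have comp: "proj_action (?Z #>\<^bsub>?S\<^esub> (A ** B)) = compose proj_points (proj_action (?Z #>\<^bsub>?S\<^esub> A)) (proj_action (?Z #>\<^bsub>?S\<^esub> B))"
    if AB: "det A = 1" "det B = 1" for A B
  proof
    fix W :: "('a ^ 'n) set"
    show "proj_action (?Z #>\<^bsub>?S\<^esub> (A ** B)) W = compose proj_points (proj_action (?Z #>\<^bsub>?S\<^esub> A)) (proj_action (?Z #>\<^bsub>?S\<^esub> B)) W"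
    proof (cases "W \<in> proj_points")
      case True
      then show ?thesis using AB
        by (simp add: compose_def proj_action_coset image_proj_point det_mul image_image matrix_vector_mul_assoc)
    qed (simp add: proj_action_def compose_def)
  qed
  have one: "proj_action (?Z #>\<^bsub>?S\<^esub> mat 1) W = W" if "W \<in> proj_points" for W
    using that by (simp add: proj_action_coset)
  have mem: "proj_action (?Z #>\<^bsub>?S\<^esub> A) W \<in> proj_points" if "det A = 1" "W \<in> proj_points" for A W
    using that by (simp add: proj_action_coset image_proj_point)
  have bij: "proj_action (?Z #>\<^bsub>?S\<^esub> A) \<in> Bij proj_points" if A: "det A = 1" for A
  proof -
    have "A \<in> carrier ?S" using A by simp
    define B where "B = inv\<^bsub>?S\<^esub> A"
    have B: "det B = 1" "A ** B = mat 1" "B ** A = mat 1"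
      using SL.inv_closed[OF \<open>A \<in> carrier ?S\<close>] SL.r_inv[OF \<open>A \<in> carrier ?S\<close>] SL.l_inv[OF \<open>A \<in> carrier ?S\<close>]
      by (simp_all add: B_def)
    have AB: "proj_action (?Z #>\<^bsub>?S\<^esub> A) (proj_action (?Z #>\<^bsub>?S\<^esub> B) W) = W" if "W \<in> proj_points" for W
      using fun_cong[OF comp[OF A B(1)], of W] that by (simp add: B(2) one compose_def)
    have BA: "proj_action (?Z #>\<^bsub>?S\<^esub> B) (proj_action (?Z #>\<^bsub>?S\<^esub> A) W) = W" if "W \<in> proj_points" for W
      using fun_cong[OF comp[OF B(1) A], of W] that by (simp add: B(3) one compose_def)
    have "bij_betw (proj_action (?Z #>\<^bsub>?S\<^esub> A)) proj_points proj_points"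
      by (rule bij_betw_byWitness[where f' = "proj_action (?Z #>\<^bsub>?S\<^esub> B)"]) (use AB BA mem A B(1) in auto)
    then show ?thesis by (simp add: Bij_def proj_action_def)
  qed
  have "proj_action \<in> hom (PSL :: ('a ^ 'n ^ 'n) set monoid) (BijGroup proj_points)"
  proof (rule homI)
    fix C :: "('a ^ 'n ^ 'n) set" assume "C \<in> carrier PSL"
    then show "proj_action C \<in> carrier (BijGroup proj_points)"
      using bij by (auto simp: PSL_def carrier_FactGroup BijGroup_def)
  next
    fix C D :: "('a ^ 'n ^ 'n) set" assume "C \<in> carrier PSL" "D \<in> carrier PSL"
    then obtain A B where AB: "det A = 1" "det B = 1" "C = ?Z #>\<^bsub>?S\<^esub> A" "D = ?Z #>\<^bsub>?S\<^esub> B"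
      by (auto simp: PSL_def carrier_FactGroup)
    then have "C \<otimes>\<^bsub>PSL\<^esub> D = ?Z #>\<^bsub>?S\<^esub> (A ** B)"
      using N.rcos_sum[of A B] by (simp add: PSL_def)
    then show "proj_action (C \<otimes>\<^bsub>PSL\<^esub> D) = proj_action C \<otimes>\<^bsub>BijGroup proj_points\<^esub> proj_action D"
      using comp bij AB by (simp add: BijGroup_def)
  qed
  then show ?thesis
    unfolding group_action_def group_hom_def group_hom_axioms_def
    by (simp add: group_PSL group_BijGroup)
qed

theorem group_permutation_wreath_product:
  assumes "group A" "group_action G \<Omega> \<rho>"
  shows "group (permutation_wreath_product A G \<Omega> \<rho>)"
proof -
  interpret A: group A by fact
  interpret act: group_action G \<Omega> \<rho> by fact
  interpret G: group G using act.group_hom by (simp add: group_hom_def)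
  have [simp]: "\<rho> g w \<in> \<Omega>" if "g \<in> carrier G" "w \<in> \<Omega>" for g w
    using act.element_image that by blast
  have mult: "\<rho> (g \<otimes>\<^bsub>G\<^esub> h) w = \<rho> g (\<rho> h w)" if "g \<in> carrier G" "h \<in> carrier G" "w \<in> \<Omega>" for g h w
    using act.composition_rule that by blast
  have one: "\<rho> \<one>\<^bsub>G\<^esub> w = w" if "w \<in> \<Omega>" for w
    using fun_cong[OF act.id_eq_one, of w] that by simp
  let ?W = "permutation_wreath_product A G \<Omega> \<rho>"
  have c: "carrier ?W = (\<Omega> \<rightarrow>\<^sub>E carrier A) \<times> carrier G"
    by (simp add: permutation_wreath_product_def semidirect_product_def)
  have m: "(v, g) \<otimes>\<^bsub>?W\<^esub> (w, h) = ((\<lambda>x\<in>\<Omega>. v x \<otimes>\<^bsub>A\<^esub> w (\<rho> (inv\<^bsub>G\<^esub> g) x)), g \<otimes>\<^bsub>G\<^esub> h)" for v g w h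
    by (auto simp: permutation_wreath_product_def semidirect_product_def permutation_module_action_def restrict_def)
  have o: "\<one>\<^bsub>?W\<^esub> = ((\<lambda>x\<in>\<Omega>. \<one>\<^bsub>A\<^esub>), \<one>\<^bsub>G\<^esub>)"
    by (simp add: permutation_wreath_product_def semidirect_product_def)
  have vm: "v x \<in> carrier A" if "v \<in> \<Omega> \<rightarrow>\<^sub>E carrier A" "x \<in> \<Omega>" for v x
    using that by (rule PiE_mem)
  show ?thesis
  proof (rule groupI)
    fix x y assume "x \<in> carrier ?W" "y \<in> carrier ?W"
    then show "x \<otimes>\<^bsub>?W\<^esub> y \<in> carrier ?W"
      by (cases x; cases y) (auto simp: c m vm)
  next
    show "\<one>\<^bsub>?W\<^esub> \<in> carrier ?W" by (auto simp: c o)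
  next
    fix x y z assume xyz: "x \<in> carrier ?W" "y \<in> carrier ?W" "z \<in> carrier ?W"
    obtain u g v h w k where xyz_eq: "x = (u, g)" "y = (v, h)" "z = (w, k)" by (metis surj_pair)
    have mem: "g \<in> carrier G" "h \<in> carrier G" "k \<in> carrier G"
      "u \<in> \<Omega> \<rightarrow>\<^sub>E carrier A" "v \<in> \<Omega> \<rightarrow>\<^sub>E carrier A" "w \<in> \<Omega> \<rightarrow>\<^sub>E carrier A" using xyz by (simp_all add: c xyz_eq)
    have "(if t \<in> \<Omega> then u t \<otimes>\<^bsub>A\<^esub> v (\<rho> (inv\<^bsub>G\<^esub> g) t) else undefined) \<otimes>\<^bsub>A\<^esub> w (\<rho> (inv\<^bsub>G\<^esub> (g \<otimes>\<^bsub>G\<^esub> h)) t)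
       = u t \<otimes>\<^bsub>A\<^esub> (if \<rho> (inv\<^bsub>G\<^esub> g) t \<in> \<Omega> then v (\<rho> (inv\<^bsub>G\<^esub> g) t) \<otimes>\<^bsub>A\<^esub> w (\<rho> (inv\<^bsub>G\<^esub> h) (\<rho> (inv\<^bsub>G\<^esub> g) t)) else undefined)"
      if t: "t \<in> \<Omega>" for t
    proof -
      have "\<rho> (inv\<^bsub>G\<^esub> (g \<otimes>\<^bsub>G\<^esub> h)) t = \<rho> (inv\<^bsub>G\<^esub> h) (\<rho> (inv\<^bsub>G\<^esub> g) t)"
        using mem t by (simp add: G.inv_mult_group mult)
      moreover have "\<rho> (inv\<^bsub>G\<^esub> g) t \<in> \<Omega>" "\<rho> (inv\<^bsub>G\<^esub> h) (\<rho> (inv\<^bsub>G\<^esub> g) t) \<in> \<Omega>" using mem t by simp_all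
      ultimately show ?thesis
        using t A.m_assoc[OF vm[OF mem(4) t] vm[OF mem(5)] vm[OF mem(6)]] by simp
    qed
    then have "restrict (\<lambda>t. restrict (\<lambda>x. u x \<otimes>\<^bsub>A\<^esub> v (\<rho> (inv\<^bsub>G\<^esub> g) x)) \<Omega> t \<otimes>\<^bsub>A\<^esub> w (\<rho> (inv\<^bsub>G\<^esub> (g \<otimes>\<^bsub>G\<^esub> h)) t)) \<Omega>
      = restrict (\<lambda>t. u t \<otimes>\<^bsub>A\<^esub> restrict (\<lambda>x. v x \<otimes>\<^bsub>A\<^esub> w (\<rho> (inv\<^bsub>G\<^esub> h) x)) \<Omega> (\<rho> (inv\<^bsub>G\<^esub> g) t)) \<Omega>"
      by (intro restrict_ext) (simp only: restrict_apply)
    moreover have "g \<otimes>\<^bsub>G\<^esub> h \<otimes>\<^bsub>G\<^esub> k = g \<otimes>\<^bsub>G\<^esub> (h \<otimes>\<^bsub>G\<^esub> k)" by (intro G.m_assoc mem)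
    ultimately show "x \<otimes>\<^bsub>?W\<^esub> y \<otimes>\<^bsub>?W\<^esub> z = x \<otimes>\<^bsub>?W\<^esub> (y \<otimes>\<^bsub>?W\<^esub> z)"
      by (simp only: xyz_eq m)
  next
    fix x assume x: "x \<in> carrier ?W"
    obtain v g where xeq: "x = (v, g)" by (metis surj_pair)
    have mem: "g \<in> carrier G" "v \<in> \<Omega> \<rightarrow>\<^sub>E carrier A" using x by (simp_all add: c xeq)
    have "(\<lambda>x\<in>\<Omega>. (\<lambda>x\<in>\<Omega>. \<one>\<^bsub>A\<^esub>) x \<otimes>\<^bsub>A\<^esub> v (\<rho> (inv\<^bsub>G\<^esub> \<one>\<^bsub>G\<^esub>) x)) = v"
    proof
      fix t show "(\<lambda>x\<in>\<Omega>. (\<lambda>x\<in>\<Omega>. \<one>\<^bsub>A\<^esub>) x \<otimes>\<^bsub>A\<^esub> v (\<rho> (inv\<^bsub>G\<^esub> \<one>\<^bsub>G\<^esub>) x)) t = v t"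
      proof (cases "t \<in> \<Omega>")
        case True then show ?thesis using vm[OF mem(2) True] one[OF True] by simp
      next
        case False then show ?thesis using PiE_arb[OF mem(2) False] by simp
      qed
    qed
    then show "\<one>\<^bsub>?W\<^esub> \<otimes>\<^bsub>?W\<^esub> x = x"
      unfolding xeq o m using mem(1) by simp
    have "v (\<rho> g t) \<in> carrier A" if "t \<in> \<Omega>" for t using vm[OF mem(2)] mem(1) that by simp
    then have "(\<lambda>x\<in>\<Omega>. (\<lambda>x\<in>\<Omega>. inv\<^bsub>A\<^esub> v (\<rho> g x)) x \<otimes>\<^bsub>A\<^esub> v (\<rho> (inv\<^bsub>G\<^esub> (inv\<^bsub>G\<^esub> g)) x)) = (\<lambda>x\<in>\<Omega>. \<one>\<^bsub>A\<^esub>)"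
      using mem(1) by (intro restrict_ext) (simp add: A.l_inv)
    then have "((\<lambda>x\<in>\<Omega>. inv\<^bsub>A\<^esub> v (\<rho> g x)), inv\<^bsub>G\<^esub> g) \<otimes>\<^bsub>?W\<^esub> x = \<one>\<^bsub>?W\<^esub>"
      unfolding xeq o m using mem(1) by simp
    moreover have "((\<lambda>x\<in>\<Omega>. inv\<^bsub>A\<^esub> v (\<rho> g x)), inv\<^bsub>G\<^esub> g) \<in> carrier ?W"
      unfolding c using mem(1) vm[OF mem(2)] by auto
    ultimately show "\<exists>y\<in>carrier ?W. y \<otimes>\<^bsub>?W\<^esub> x = \<one>\<^bsub>?W\<^esub>" by blast
  qed
qed

subsection \<open>Nonsplit central extensions\<close>

lemma (in group) iso_prime_order:
  assumes "prime r" "order G = r"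
  shows "\<exists>\<iota>. \<iota> \<in> iso (integer_mod_group r) G"
proof -
  have fin: "finite (carrier G)" using assms prime_gt_0_nat[OF assms(1)] by (metis card.infinite less_numeral_extra(3) order_def)
  obtain x where x: "x \<in> carrier G" "x \<noteq> \<one>"
  proof -
    have "carrier G \<noteq> {\<one>}" using assms by (auto simp: order_def)
    then show thesis using that by blast
  qed
  have "ord x dvd r" using ord_dvd_group_order[OF x(1)] assms by simp
  moreover have "ord x \<noteq> 1" using x ord_eq_1 by auto
  ultimately have ordx: "ord x = r" using assms(1) by (auto simp: prime_nat_iff)
  have r0: "r > 0" using assms(1) prime_gt_0_nat by blast
  define \<iota> where "\<iota> = (\<lambda>k::int. x [^] k)"
  have eq: "x [^] (a::int) = x [^] b \<longleftrightarrow> int r dvd b - a" for a b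
    using int_pow_eq[OF x(1), of a b] ordx by (simp add: dvd_diff_commute)
  have hom: "\<iota> \<in> hom (integer_mod_group r) G"
  proof (rule homI)
    fix a b :: int
    have "x [^] ((a + b) mod int r) = x [^] (a + b)" by (simp add: eq)
    then show "\<iota> (a \<otimes>\<^bsub>integer_mod_group r\<^esub> b) = \<iota> a \<otimes> \<iota> b"
      using x by (simp add: \<iota>_def int_pow_mult)
  qed (use x in \<open>simp add: \<iota>_def\<close>)
  have inj: "inj_on \<iota> (carrier (integer_mod_group r))"
  proof (rule inj_onI)
    fix a b assume "a \<in> carrier (integer_mod_group r)" "b \<in> carrier (integer_mod_group r)" "\<iota> a = \<iota> b"
    then have "a mod int r = a" "b mod int r = b" "int r dvd b - a"
      using r0 by (auto simp: carrier_integer_mod_group \<iota>_def eq)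
    then show "a = b" by (metis mod_eq_dvd_iff)
  qed
  moreover have "\<iota> ` carrier (integer_mod_group r) = carrier G"
  proof (rule card_subset_eq[OF fin])
    show "\<iota> ` carrier (integer_mod_group r) \<subseteq> carrier G" using x by (auto simp: \<iota>_def)
    show "card (\<iota> ` carrier (integer_mod_group r)) = card (carrier G)"
      using inj r0 assms by (simp add: card_image carrier_integer_mod_group order_def)
  qed
  ultimately show ?thesis using hom by (auto simp: iso_def bij_betw_def)
qed

lemma central_quotient_nonsplit:
  fixes S (structure)
  assumes "group S" and N: "subgroup N (S\<lparr>carrier := group_center S\<rparr>)"
    and card: "card (rcosets\<^bsub>S\<lparr>carrier := group_center S\<rparr>\<^esub> N) = r" and r: "prime r" "coprime q r"
    and K: "\<And>K. subgroup K S \<Longrightarrow> {x \<in> carrier S. x [^] (q::nat) = \<one>} \<subseteq> K \<Longrightarrow> group_center S \<subseteq> K"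
  shows "nonsplit_central_extension r (S Mod N) (S Mod group_center S)"
proof -
  interpret group S by fact
  let ?Z = "group_center S"
  let ?ZS = "S\<lparr>carrier := ?Z\<rparr>"
  interpret Zn: normal ?Z S by (intro normal_of_le_center subgroup_group_center subset_refl)
  have NZ: "N \<subseteq> ?Z" using subgroup.subset[OF N] by simp
  have Ns: "subgroup N S" using N incl_subgroup[OF subgroup_group_center] by blast
  interpret Nn: normal N S by (rule normal_of_le_center[OF Ns NZ])
  interpret ZS: group ?ZS by (rule subgroup_imp_group[OF subgroup_group_center])
  have comm: "comm_group ?ZS"
    by (rule ZS.group_comm_groupI) (auto dest: group_centerD)
  have "N \<lhd> ?ZS" using comm_group.normal_iff_subgroup[OF comm] N by blast
  then interpret ZN: normal N ?ZS .
  interpret Q: group "?ZS Mod N" by (rule ZN.factorgroup_is_group)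
  interpret B: group "S Mod N" by (rule Nn.factorgroup_is_group)
  interpret G: group "S Mod ?Z" by (rule Zn.factorgroup_is_group)
  have "order (?ZS Mod N) = r" using card by (simp add: order_def FactGroup_def)
  then obtain \<iota> where \<iota>: "\<iota> \<in> iso (integer_mod_group r) (?ZS Mod N)"
    using Q.iso_prime_order r by blast
  have cQ: "carrier (?ZS Mod N) = (\<lambda>z. N #> z) ` ?Z"
    by (simp add: carrier_FactGroup r_coset_def)
  have img: "\<iota> ` carrier (integer_mod_group r) = (\<lambda>z. N #> z) ` ?Z"
    using \<iota> cQ by (auto simp: iso_def bij_betw_def)
  have mon: "\<iota> \<in> mon (integer_mod_group r) (S Mod N)"
  proof -
    have "\<iota> ` carrier (integer_mod_group r) \<subseteq> carrier (S Mod N)"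
      using img Zn.subset by (auto simp: carrier_FactGroup)
    moreover have "inj_on \<iota> (carrier (integer_mod_group r))" using \<iota> by (auto simp: iso_def bij_betw_def)
    moreover have "\<iota> (a \<otimes>\<^bsub>integer_mod_group r\<^esub> b) = \<iota> a \<otimes>\<^bsub>S Mod N\<^esub> \<iota> b"
      if "a \<in> carrier (integer_mod_group r)" "b \<in> carrier (integer_mod_group r)" for a b
    proof -
      have "\<iota> (a \<otimes>\<^bsub>integer_mod_group r\<^esub> b) = \<iota> a <#>\<^bsub>?ZS\<^esub> \<iota> b"
        using \<iota> that unfolding iso_def hom_def mult_FactGroup by blast
      then show ?thesis by (simp add: set_mult_def)
    qed
    ultimately show ?thesis unfolding mon_def hom_def by blast
  qed
  have sub: "?Z #> x = ?Z #> y" if xy: "x \<in> carrier S" "y \<in> carrier S" "N #> x = N #> y" for x y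
  proof -
    have "x \<in> N #> y" using rcos_self[OF xy(1) Ns] xy(3) by blast
    then have "x \<in> ?Z #> y" using NZ by (auto simp: r_coset_def)
    then show ?thesis using repr_independence[OF _ xy(2) subgroup_group_center] by simp
  qed
  obtain \<pi> where \<pi>: "\<pi> \<in> hom (S Mod N) (S Mod ?Z)" "\<And>x. x \<in> carrier S \<Longrightarrow> \<pi> (N #> x) = ?Z #> x"
    using FactGroup_universal[OF Zn.r_coset_hom_Mod Nn.normal_axioms] sub by blast
  have epi: "\<pi> \<in> epi (S Mod N) (S Mod ?Z)"
    using \<pi> by (force simp: epi_iff_subset carrier_FactGroup)
  have mem_Z: "?Z #> x = ?Z \<longleftrightarrow> x \<in> ?Z" if "x \<in> carrier S" for x
    using that coset_join1[OF _ that subgroup_group_center] coset_join2[OF that subgroup_group_center] subgroup_group_center by auto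
  have ker: "kernel (S Mod N) (S Mod ?Z) \<pi> = \<iota> ` carrier (integer_mod_group r)"
    unfolding img using \<pi>(2) mem_Z Zn.subset by (auto simp: kernel_def carrier_FactGroup)
  have cent: "\<iota> ` carrier (integer_mod_group r) \<subseteq> group_center (S Mod N)"
    unfolding img
  proof clarify
    fix z assume z: "z \<in> ?Z"
    note zc = group_centerD(1)[OF z]
    show "N #> z \<in> group_center (S Mod N)"
    proof (rule group_centerI)
      show "N #> z \<in> carrier (S Mod N)" using zc by (auto simp: carrier_FactGroup)
      fix C assume "C \<in> carrier (S Mod N)"
      then obtain x where x: "x \<in> carrier S" "C = N #> x" by (auto simp: carrier_FactGroup)
      have "N #> x <#> (N #> z) = N #> z <#> (N #> x)"
        using x(1) zc by (simp add: Nn.rcos_sum group_centerD(2)[OF z])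
      then show "C \<otimes>\<^bsub>S Mod N\<^esub> (N #> z) = (N #> z) \<otimes>\<^bsub>S Mod N\<^esub> C" using x(2) by simp
    qed
  qed
  have ce: "central_extension (integer_mod_group r) (S Mod N) (S Mod ?Z) \<iota> \<pi>"
    unfolding central_extension_def using mon epi ker cent B.is_group G.is_group by simp
  note one_FactGroup [simp del] mult_FactGroup [simp del]
  have "\<not> (\<exists>\<sigma> \<in> hom (S Mod ?Z) (S Mod N). \<forall>g \<in> carrier (S Mod ?Z). \<pi> (\<sigma> g) = g)"
  proof
    assume "\<exists>\<sigma> \<in> hom (S Mod ?Z) (S Mod N). \<forall>g \<in> carrier (S Mod ?Z). \<pi> (\<sigma> g) = g"
    then obtain \<sigma> where \<sigma>: "\<sigma> \<in> hom (S Mod ?Z) (S Mod N)" "\<And>g. g \<in> carrier (S Mod ?Z) \<Longrightarrow> \<pi> (\<sigma> g) = g" by blast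
    define f where "f = (\<lambda>x. \<sigma> (?Z #> x))"
    define p where "p = (\<lambda>x. N #> x)"
    have "f \<in> hom S (S Mod N)"
    proof (rule homI)
      fix x assume "x \<in> carrier S"
      then show "f x \<in> carrier (S Mod N)"
        unfolding f_def by (intro hom_in_carrier[OF \<sigma>(1)] hom_in_carrier[OF Zn.r_coset_hom_Mod])
    next
      fix x y assume "x \<in> carrier S" "y \<in> carrier S"
      then show "f (x \<otimes> y) = f x \<otimes>\<^bsub>S Mod N\<^esub> f y"
        unfolding f_def
        by (simp only: hom_mult[OF Zn.r_coset_hom_Mod] hom_mult[OF \<sigma>(1)] hom_in_carrier[OF Zn.r_coset_hom_Mod])
    qed
    then interpret f: group_hom S "S Mod N" f
      unfolding group_hom_def group_hom_axioms_def using is_group B.is_group by blast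
    interpret p: group_hom S "S Mod N" p
      unfolding p_def group_hom_def group_hom_axioms_def
      using Nn.r_coset_hom_Mod is_group B.is_group by simp
    interpret pi: group_hom "S Mod N" "S Mod ?Z" \<pi>
      unfolding group_hom_def group_hom_axioms_def using \<pi>(1) B.is_group G.is_group by simp
    let ?K = "{x \<in> carrier S. f x = p x}"
    have subK: "subgroup ?K S"
      by unfold_locales auto
    have "x \<in> ?K" if x: "x \<in> carrier S" "x [^] q = \<one>" for x
    proof -
      define u where "u = p x"
      define v where "v = f x"
      have uv: "u \<in> carrier (S Mod N)" "v \<in> carrier (S Mod N)" using x by (auto simp: u_def v_def)
      define w where "w = u \<otimes>\<^bsub>S Mod N\<^esub> inv\<^bsub>S Mod N\<^esub> v"
      have w: "w \<in> carrier (S Mod N)" using uv by (simp add: w_def)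
      have xZ: "?Z #> x \<in> carrier (S Mod ?Z)" using x(1) by (auto simp: carrier_FactGroup)
      have "\<pi> u = \<pi> v" using x(1) \<pi>(2) \<sigma>(2)[OF xZ] by (simp add: u_def v_def p_def f_def)
      then have "\<pi> w = \<one>\<^bsub>S Mod ?Z\<^esub>" using uv by (simp add: w_def)
      then have wk: "w \<in> \<iota> ` carrier (integer_mod_group r)" using ker w by (auto simp: kernel_def)
      then have wc: "w \<in> group_center (S Mod N)" using cent by blast
      have wr: "w [^]\<^bsub>S Mod N\<^esub> r = \<one>\<^bsub>S Mod N\<^esub>"
      proof -
        from wk obtain k where k: "w = \<iota> k" "k \<in> carrier (integer_mod_group r)" by blast
        interpret i: group_hom "integer_mod_group r" "S Mod N" \<iota>
          unfolding group_hom_def group_hom_axioms_def using mon B.is_group by (simp add: mon_def)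
        have "w [^]\<^bsub>S Mod N\<^esub> r = \<iota> (k [^]\<^bsub>integer_mod_group r\<^esub> r)" using k(1) i.hom_nat_pow[OF k(2), of r] by (simp only:)
        also have "k [^]\<^bsub>integer_mod_group r\<^esub> r = \<one>\<^bsub>integer_mod_group r\<^esub>" by simp
        finally show ?thesis by (simp only: i.hom_one)
      qed
      have uq: "u [^]\<^bsub>S Mod N\<^esub> q = \<one>\<^bsub>S Mod N\<^esub>" "v [^]\<^bsub>S Mod N\<^esub> q = \<one>\<^bsub>S Mod N\<^esub>"
        unfolding u_def v_def using x p.hom_nat_pow[of x q] f.hom_nat_pow[of x q] p.hom_one f.hom_one by metis+
      have uwv: "u = w \<otimes>\<^bsub>S Mod N\<^esub> v" using uv by (simp add: w_def B.m_assoc)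
      have "u [^]\<^bsub>S Mod N\<^esub> q = w [^]\<^bsub>S Mod N\<^esub> q \<otimes>\<^bsub>S Mod N\<^esub> v [^]\<^bsub>S Mod N\<^esub> q"
        unfolding uwv by (rule B.pow_mult_distrib[OF _ w uv(2)]) (rule group_centerD(2)[OF wc uv(2), symmetric])
      then have wq: "w [^]\<^bsub>S Mod N\<^esub> q = \<one>\<^bsub>S Mod N\<^esub>" using uq w by (metis B.nat_pow_closed B.r_one)
      have "B.ord w dvd q" "B.ord w dvd r" using wq wr w by (simp_all add: B.pow_eq_id)
      then have "B.ord w = 1" using r(2) by (metis coprime_common_divisor_nat)
      then have "w = \<one>\<^bsub>S Mod N\<^esub>" using B.ord_eq_1[OF w] by simp
      then have "u = v" using uwv uv(2) by (metis B.l_one)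
      then show ?thesis using x(1) by (simp add: u_def v_def)
    qed
    then have ZK: "?Z \<subseteq> ?K" by (intro K[OF subK]) blast
    have "z \<in> N" if z: "z \<in> ?Z" for z
    proof -
      note zc = group_centerD(1)[OF z]
      have "?Z #> z = \<one>\<^bsub>S Mod ?Z\<^esub>" using mem_Z[OF zc] z by (simp add: one_FactGroup)
      then have "f z = \<one>\<^bsub>S Mod N\<^esub>"
        unfolding f_def using hom_one[OF \<sigma>(1) G.is_group B.is_group] by metis
      then have "N #> z = N" using ZK z by (auto simp: p_def one_FactGroup)
      then show "z \<in> N" using coset_join1[OF _ zc Ns] by simp
    qed
    then have NZeq: "N = ?Z" using NZ by blast
    have "N #> z = N" if "z \<in> ?Z" for z
      unfolding NZeq by (rule coset_join2[OF group_centerD(1)[OF that] subgroup_group_center that])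
    then have "(\<lambda>z. N #> z) ` ?Z = {N}"
      using subgroup.one_closed[OF subgroup_group_center] by (blast intro: sym)
    then have "carrier (?ZS Mod N) = {N}" by (simp only: cQ)
    then have "r = 1" using \<open>order (?ZS Mod N) = r\<close> by (simp add: order_def)
    then show False using r by simp
  qed
  with ce show ?thesis unfolding nonsplit_central_extension_def by blast
qed

lemma transvection_pow:
  fixes t :: "'a::field"
  assumes "i \<noteq> (j :: 'n::finite)"
  shows "transvection i j t [^]\<^bsub>SL\<^esub> (m::nat) = transvection i j (of_nat m * t)"
proof (induction m)
  case 0
  show ?case by (simp add: transvection_def mat_def vec_eq_iff)
next
  case (Suc m)
  have "transvection i j (of_nat m * t) ** transvection i j t = transvection i j (of_nat (Suc m) * t)"
    using assms by (subst transvection_mult(2)) (auto simp: transvection_def vec_eq_iff algebra_simps)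
  with Suc show ?case by simp
qed

lemma subgroup_of_transvections_contains_diag:
  fixes c :: "'a::field" and k :: "'n::finite"
  assumes K: "subgroup K SL" and tv: "\<And>i j t. i \<noteq> j \<Longrightarrow> transvection i j t \<in> K"
    and c: "c \<noteq> 0" and S: "finite S" "k \<notin> S"
  shows "(\<chi> a b. if a = b then if a \<in> S then c else if a = k then inverse c ^ card S else 1 else 0) \<in> (K :: ('a ^ 'n ^ 'n) set)"
  using S
proof (induction S rule: finite_induct)
  case empty
  have "mat 1 \<in> K" using subgroup.one_closed[OF K] by simp
  moreover have "mat 1 = (\<chi> a b. if a = b then if a \<in> {} then c else if a = k then inverse c ^ card {} else 1 else 0)"
    by (auto simp: mat_def vec_eq_iff)
  ultimately show ?case by metis
next
  case (insert i S)
  let ?D = "(\<chi> a b. if a = b then if a \<in> S then c else if a = k then inverse c ^ card S else 1 else 0) :: 'a ^ 'n ^ 'n"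
  let ?E = "(\<chi> a b. if a = b then if a \<in> insert i S then c else if a = k then inverse c ^ card (insert i S) else 1 else 0) :: 'a ^ 'n ^ 'n"
  have ik: "i \<noteq> k" using insert by auto
  have D: "?D \<in> K" using insert by auto
  have mK: "A ** B \<in> K" if "A \<in> K" "B \<in> K" for A B using subgroup.m_closed[OF K that] by simp
  have "transvection i k c ** (transvection k i (- inverse c) ** (transvection i k c **
      (transvection i k (-1) ** (transvection k i 1 ** (transvection i k (-1) ** ?D))))) = ?E"
    using ik insert(1,2) insert.prems c
    by (auto simp: transvection_mult vec_eq_iff field_simps)
  moreover have "transvection i k c ** (transvection k i (- inverse c) ** (transvection i k c **
      (transvection i k (-1) ** (transvection k i 1 ** (transvection i k (-1) ** ?D))))) \<in> K"
    using ik D by (intro mK tv) auto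
  ultimately show ?case by metis
qed

theorem SL_Mod_nonsplit_central_extension:
  fixes Z' :: "('a::{field, finite} ^ 'n ^ 'n) set"
  assumes "prime r" "r dvd gcd CARD('n) (CARD('a) - 1)"
    and "subgroup Z' (SL\<lparr>carrier := group_center SL\<rparr>)"
    and "card (rcosets\<^bsub>SL\<lparr>carrier := group_center SL\<rparr>\<^esub> Z') = r"
  shows "nonsplit_central_extension r (SL Mod Z') (PSL :: ('a ^ 'n ^ 'n) set monoid)"
  unfolding PSL_def
proof (rule central_quotient_nonsplit[OF group_SL assms(3,4,1)])
  have "CARD('a) > 0" by simp
  then show "coprime CARD('a) r"
    using assms(2) by (metis coprime_commute coprime_diff_one_left_nat coprime_divisors dvd_refl gcd_nat.boundedE)
  fix K :: "('a ^ 'n ^ 'n) set"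
  assume K: "subgroup K SL" and gen: "{x \<in> carrier SL. x [^]\<^bsub>SL\<^esub> CARD('a) = \<one>\<^bsub>SL\<^esub>} \<subseteq> K"
  have "of_nat CARD('a) = (0 :: 'a)"
    using CHAR_dvd_CARD[where ?'a = 'a] by (simp add: of_nat_eq_0_iff_char_dvd)
  moreover have "transvection i j (0 :: 'a) = mat 1" for i j :: 'n
    by (simp add: transvection_def mat_def vec_eq_iff)
  ultimately have tv: "transvection i j t \<in> K" if "i \<noteq> j" for i j t
    using gen det_transvection[OF that, of t] transvection_pow[OF that, of t "CARD('a)"] by auto
  show "group_center SL \<subseteq> K"
  proof
    fix z :: "'a ^ 'n ^ 'n" assume "z \<in> group_center SL"
    then obtain c where c: "z = mat c" "c ^ CARD('n) = 1" using center_SL_scalar by blast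
    fix k :: 'n
    have c0: "c \<noteq> 0" using c(2) by (metis zero_less_card_finite zero_neq_one zero_power)
    have cn: "CARD('n) = Suc (card (UNIV - {k}))" by (simp add: card_Diff_singleton)
    have "c * c ^ card (UNIV - {k}) = 1" using c(2) by (simp only: cn power_Suc)
    then have ck: "inverse c ^ card (UNIV - {k}) = c"
      using c0 by (simp add: field_simps)
    have "(\<chi> a b. if a = b then if a \<in> UNIV - {k} then c else if a = k then inverse c ^ card (UNIV - {k}) else 1 else 0) \<in> K"
      by (rule subgroup_of_transvections_contains_diag[OF K tv c0]) auto
    also have "(\<chi> a b. if a = b then if a \<in> UNIV - {k} then c else if a = k then inverse c ^ card (UNIV - {k}) else 1 else 0) = z"
      unfolding ck c(1) by (auto simp: mat_def vec_eq_iff)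
    finally show "z \<in> K" .
  qed
qed

end

(*
  Write S = SL_n(q), Z = Z(S), e = (q - 1) / gcd(n, q - 1), and let W be the wreath product. The
  kernel of an embedding of S/Z' into W, composed with S -> S/Z', is Z'.

  If r does not divide e, choose a nonzero vector e_x in every point x. Then A e_x = c(A, x) e_(Ax)
  for scalars c(A, x), so that S acts by monomial matrices. Composing c with the homomorphism L from
  the multiplicative group of F_q onto Z_r gives a homomorphism from S to W. It maps a scalar matrix
  z in Z to the constant function L(z), and L does not vanish on Z because r does not divide e; hence
  its kernel is Z'.

  Suppose that r divides e and that S -> W has kernel Z'. The preimage M in S of the base group is
  normal, and its elements have r-th power in Z'; commutators with transvections show that M
  consists of scalars. Comparing orders, M = Z and S -> W -> PSL_n(q) is onto. Since r divides e, every
  element of Z is the r-th power of a scalar a. Take zeta in Z outside Z'; then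
  diag(a, ..., a, a^(1-n)) has r-th power zeta, and its image in PSL_n(q) is represented by a matrix
  B with B^r = b^r for a scalar b. Such a B has an eigenvector, i.e. fixes a point x. So the value
  at x of the image of zeta in the base group is r times an element of Z_r, hence 0. But this image
  is central, hence constant, hence 0, which contradicts the choice of zeta.
*)

theory Submission
  imports Defs
begin

section \<open>Power residues in finite fields\<close>

text \<open>The multiplicative group of a finite field is cyclic. The type is wrapped into a
  HOL-Algebra field record \<open>R\<close>, and the order of a generator of
  \<open>mult_of R\<close> is translated back into ordinary powers.\<close>

lemma finite_field_generator:
  obtains g :: "'a::{field, finite}" where "g \<noteq> 0" "\<And>x. x \<noteq> 0 \<Longrightarrow> \<exists>k::nat. x = g ^ k"
    "\<And>k::nat. g ^ k = 1 \<longleftrightarrow> (CARD('a) - 1) dvd k"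
proof -
  define R where "R = (\<lparr>carrier = UNIV, monoid.mult = (*), one = 1, ring.zero = 0, add = (+)\<rparr> :: 'a ring)"
  have ex_inv: "\<exists>y. x + y = 0" "x \<noteq> 0 \<Longrightarrow> \<exists>y. x * y = 1" for x :: 'a
    by (rule exI[of _ "- x"], simp) (rule exI[of _ "inverse x"], simp)
  interpret R: field R
    by unfold_locales (auto simp: R_def algebra_simps Units_def ex_inv)
  interpret U: group "mult_of R" by (rule R.field_mult_group)
  have R_simps: "carrier R = UNIV" "mult R = (*)" "\<one>\<^bsub>R\<^esub> = 1" "\<zero>\<^bsub>R\<^esub> = 0"
    by (auto simp: R_def)
  have pow: "x [^]\<^bsub>mult_of R\<^esub> k = x ^ k" for x and k :: nat
    by (induction k) (auto simp: R_simps nat_pow_mult_of mult.commute)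
  have fin: "finite (carrier (mult_of R))" by (simp add: R_simps)
  obtain g where g: "g \<in> carrier (mult_of R)" "carrier (mult_of R) = {g [^]\<^bsub>R\<^esub> i | i::nat. i \<in> UNIV}"
    using R.finite_field_mult_group_has_gen R_simps by auto
  have "generate (mult_of R) {g} = carrier (mult_of R)"
    using U.generate_pow_on_finite_carrier[OF fin g(1)] g(2) by (simp add: nat_pow_mult_of)
  then have "U.ord g = card (carrier (mult_of R))"
    using U.generate_pow_card[OF g(1)] by simp
  also have "\<dots> = CARD('a) - 1" by (simp add: R_simps card_Diff_singleton)
  finally have "g ^ k = 1 \<longleftrightarrow> (CARD('a) - 1) dvd k" for k
    using U.pow_eq_id[OF g(1), of k] by (simp add: pow R_simps)
  moreover have "\<exists>k::nat. x = g ^ k" if "x \<noteq> 0" for x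
  proof -
    have "x \<in> carrier (mult_of R)" using that by (simp add: R_simps)
    then obtain i :: nat where "x = g [^]\<^bsub>R\<^esub> i" using g(2) by blast
    then show ?thesis using pow[of g i] by (auto simp: nat_pow_mult_of)
  qed
  ultimately show thesis using that g(1) by (simp add: R_simps)
qed

lemma pow_card_pred_eq_1: "x \<noteq> 0 \<Longrightarrow> x ^ (CARD('a) - 1) = (1 :: 'a::{field, finite})"
proof -
  assume "x \<noteq> 0"
  obtain g :: 'a where g: "g \<noteq> 0" "\<And>x. x \<noteq> 0 \<Longrightarrow> \<exists>k::nat. x = g ^ k"
    "\<And>k::nat. g ^ k = 1 \<longleftrightarrow> (CARD('a) - 1) dvd k"
    by (rule finite_field_generator) blast
  obtain k where "x = g ^ k" using g(2)[OF \<open>x \<noteq> 0\<close>] by blast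
  then show ?thesis using g(3)[of "k * (CARD('a) - 1)"] by (simp add: power_mult)
qed

lemma one_less_CARD_field: "1 < CARD('a::{field, finite})"
  using card_mono[of "UNIV :: 'a set" "{0, 1}"] by simp

lemma pow_card_eq_self: "x ^ CARD('a) = (x :: 'a::{field, finite})"
proof (cases "x = 0")
  case False
  have "CARD('a) = Suc (CARD('a) - 1)" using one_less_CARD_field[where 'a = 'a] by simp
  then have "x ^ CARD('a) = x * x ^ (CARD('a) - 1)" by (metis power_Suc)
  then show ?thesis using pow_card_pred_eq_1[OF False] by simp
qed (simp add: one_less_CARD_field)

lemma of_nat_CARD_eq_0: "of_nat CARD('a) = (0 :: 'a::{field, finite})"
  using CHAR_dvd_CARD[where ?'a = 'a] by (simp add: of_nat_eq_0_iff_char_dvd)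

text \<open>With q - 1 = r * m, vanishing of r in the field would give 0 = q = 1 there. This makes
  division by r possible for unipotent matrices later on.\<close>

lemma of_nat_dvd_card_pred_neq_0:
  assumes "r dvd CARD('a) - 1"
  shows "of_nat r \<noteq> (0 :: 'a::{field, finite})"
proof
  assume r0: "of_nat r = (0 :: 'a)"
  obtain m where m: "CARD('a) - 1 = r * m" using assms by blast
  then have "CARD('a) = r * m + 1" using one_less_CARD_field[where 'a = 'a] by linarith
  then have "of_nat CARD('a) = (of_nat r * of_nat m + 1 :: 'a)" by (metis of_nat_1 of_nat_add of_nat_mult)
  then show False using r0 of_nat_CARD_eq_0[where 'a = 'a] by simp
qed

text \<open>If g generates the multiplicative group and q - 1 = r * m, the elements
  \<open>a * g ^ (m * i)\<close> for i < r are distinct roots.\<close>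

lemma card_roots_of_power:
  fixes a :: "'a::{field, finite}"
  assumes "a \<noteq> 0" "r dvd CARD('a) - 1"
  shows "r \<le> card {b. b ^ r = a ^ r}"
proof -
  obtain g :: 'a where g: "g \<noteq> 0" "\<And>x. x \<noteq> 0 \<Longrightarrow> \<exists>k::nat. x = g ^ k"
    "\<And>k::nat. g ^ k = 1 \<longleftrightarrow> (CARD('a) - 1) dvd k"
    by (rule finite_field_generator) blast
  obtain m where m: "CARD('a) - 1 = r * m" using assms(2) by blast
  have m0: "m > 0" "r > 0" using m one_less_CARD_field[where 'a = 'a] by (auto intro!: Nat.gr0I)
  have inj: "inj_on (\<lambda>i. a * g ^ (m * i)) {..<r}"
  proof (rule linorder_inj_onI)
    fix i j assume ij: "i < j" "i \<in> {..<r}" "j \<in> {..<r}"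
    show "a * g ^ (m * i) \<noteq> a * g ^ (m * j)"
    proof
      assume "a * g ^ (m * i) = a * g ^ (m * j)"
      moreover have "m * j = m * i + m * (j - i)" using ij by (simp flip: distrib_left)
      ultimately have "g ^ (m * (j - i)) = 1" using assms(1) g(1) by (simp add: power_add)
      then have "r * m dvd (j - i) * m" by (metis g(3) m mult.commute)
      then have "r dvd j - i" using m0 by simp
      then show False using ij by (auto dest: dvd_imp_le)
    qed
  qed auto
  have "(g ^ (m * i)) ^ r = 1" for i
  proof -
    have "(g ^ (m * i)) ^ r = (g ^ (r * m)) ^ i" by (simp add: ac_simps flip: power_mult)
    then show ?thesis using g(3)[of "r * m"] by (simp only: m dvd_refl simp_thms power_one)
  qed
  then have "(\<lambda>i. a * g ^ (m * i)) ` {..<r} \<subseteq> {b. b ^ r = a ^ r}"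
    by (auto simp: power_mult_distrib)
  then have "card ((\<lambda>i. a * g ^ (m * i)) ` {..<r}) \<le> card {b. b ^ r = a ^ r}"
    by (intro card_mono) auto
  then show ?thesis using inj by (simp add: card_image)
qed

text \<open>\<open>L\<close> is the discrete logarithm to base g, reduced modulo r. Reduction is
  well defined because r divides the order of g, and the logarithms divisible by r are those of r-th
  powers. The value at 0 carries no meaning.\<close>

lemma residue_character:
  assumes "r dvd CARD('a::{field, finite}) - 1" "r > 0"
  obtains L :: "'a::{field, finite} \<Rightarrow> int" where "\<And>x. L x \<in> {0..<int r}"
    "\<And>x y. x \<noteq> 0 \<Longrightarrow> y \<noteq> 0 \<Longrightarrow> L (x * y) = (L x + L y) mod int r"
    "\<And>x. x \<noteq> 0 \<Longrightarrow> L x = 0 \<longleftrightarrow> (\<exists>y. y \<noteq> 0 \<and> x = y ^ r)"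
proof -
  obtain g :: 'a where g: "g \<noteq> 0" "\<And>x. x \<noteq> 0 \<Longrightarrow> \<exists>k::nat. x = g ^ k"
    "\<And>k::nat. g ^ k = 1 \<longleftrightarrow> (CARD('a) - 1) dvd k"
    by (rule finite_field_generator) blast
  define l where "l = (\<lambda>x. SOME k. x = g ^ k)"
  have l: "x = g ^ l x" if "x \<noteq> 0" for x
    unfolding l_def using g(2)[OF that] by (rule someI_ex)
  have le: "int i mod int r = int j mod int r" if "g ^ i = g ^ j" "i \<le> j" for i j
  proof -
    have "g ^ j = g ^ i * g ^ (j - i)" using that(2) by (simp flip: power_add)
    then have "g ^ (j - i) = 1" using that(1) g(1) by simp
    then have "r dvd j - i" using assms g(3) dvd_trans by blast
    then have "[j = i] (mod r)" using that(2) by (simp add: cong_altdef_nat)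
    then show ?thesis by (metis cong_def of_nat_mod)
  qed
  have eq: "int i mod int r = int j mod int r" if "g ^ i = g ^ j" for i j
    using le[OF that] le[OF that[symmetric]] by linarith
  define L where "L = (\<lambda>x. int (l x) mod int r)"
  show thesis
  proof
    show "L x \<in> {0..<int r}" for x using assms(2) by (simp add: L_def)
    fix x y :: 'a assume xy: "x \<noteq> 0" "y \<noteq> 0"
    have "g ^ l (x * y) = g ^ (l x + l y)"
      using l[OF xy(1)] l[OF xy(2)] l[of "x * y"] xy by (simp add: power_add)
    then show "L (x * y) = (L x + L y) mod int r"
      by (auto dest!: eq simp: L_def mod_add_eq)
  next
    fix x :: 'a assume x: "x \<noteq> 0"
    show "L x = 0 \<longleftrightarrow> (\<exists>y. y \<noteq> 0 \<and> x = y ^ r)"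
    proof
      assume "L x = 0"
      then have "r dvd l x" by (simp add: L_def mod_eq_0_iff_dvd flip: of_nat_mod)
      then obtain m where "l x = m * r" by (metis dvd_div_mult_self)
      then have "x = (g ^ m) ^ r" using l[OF x] by (simp add: power_mult)
      then show "\<exists>y. y \<noteq> 0 \<and> x = y ^ r" using g(1) by (intro exI[of _ "g ^ m"]) simp
    next
      assume "\<exists>y. y \<noteq> 0 \<and> x = y ^ r"
      then obtain y where y: "y \<noteq> 0" "x = y ^ r" by blast
      then have "g ^ l x = g ^ (l y * r)" using l[OF x] l[OF y(1)] by (simp add: power_mult)
      then show "L x = 0" by (auto dest!: eq simp: L_def)
    qed
  qed
qed

text \<open>Put d = gcd n (q - 1), n = d * n' and q - 1 = d * e. The condition d * e dvd k * d * n'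
  reduces to e dvd k because e and n' are coprime.\<close>

lemma root_of_unity_exponent:
  assumes "x \<noteq> 0" "x = (g :: 'a::{field, finite}) ^ k" "\<And>k::nat. g ^ k = 1 \<longleftrightarrow> (CARD('a) - 1) dvd k"
  shows "x ^ n = 1 \<longleftrightarrow> (CARD('a) - 1) div gcd n (CARD('a) - 1) dvd k"
proof -
  let ?N = "CARD('a) - 1"
  define d where "d = gcd n ?N"
  have d0: "d > 0" using one_less_CARD_field[where 'a = 'a] by (simp add: d_def)
  have "d dvd n" "d dvd ?N" by (simp_all add: d_def)
  then obtain n' e where n': "n = d * n'" "?N = d * e" by (auto elim!: dvdE)
  have cop: "coprime e n'"
  proof -
    have "gcd (d * n') (d * e) = d" by (simp only: flip: n' d_def)
    then have "d * gcd n' e = d" by (simp add: gcd_mult_distrib_nat)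
    then show ?thesis using d0 by (simp add: coprime_iff_gcd_eq_1 gcd.commute)
  qed
  have "x ^ n = 1 \<longleftrightarrow> ?N dvd k * n" by (simp add: assms(2) assms(3) flip: power_mult)
  also have "\<dots> \<longleftrightarrow> d * e dvd d * (k * n')"
    unfolding n'(2) by (subst n'(1)) (simp only: ac_simps)
  also have "\<dots> \<longleftrightarrow> e dvd k * n'" using d0 by simp
  also have "\<dots> \<longleftrightarrow> e dvd k" using cop by (simp add: coprime_dvd_mult_left_iff)
  finally show ?thesis unfolding d_def[symmetric] unfolding n'(2) using d0 by simp
qed

text \<open>The exponent of c is a multiple of e = (q - 1) / gcd n (q - 1), hence of r.\<close>

lemma root_of_unity_is_power:
  fixes c :: "'a::{field, finite}"
  assumes "c \<noteq> 0" "c ^ n = 1" "r dvd (CARD('a) - 1) div gcd n (CARD('a) - 1)"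
  obtains b where "b \<noteq> 0" "c = b ^ r"
proof -
  obtain g :: 'a where g: "g \<noteq> 0" "\<And>x. x \<noteq> 0 \<Longrightarrow> \<exists>k::nat. x = g ^ k"
    "\<And>k::nat. g ^ k = 1 \<longleftrightarrow> (CARD('a) - 1) dvd k"
    by (rule finite_field_generator) blast
  obtain k where k: "c = g ^ k" using g(2)[OF assms(1)] by blast
  then have "r dvd k" using root_of_unity_exponent[OF assms(1) k g(3)] assms(2,3) dvd_trans by blast
  then obtain m where "k = m * r" by (metis dvd_div_mult_self)
  then show thesis using k g(1) that[of "g ^ m"] by (simp add: power_mult)
qed

text \<open>Here r is coprime to e = (q - 1) / gcd n (q - 1). If b = g ^ k, then e divides k * r and
  therefore k, so the given b is already an n-th root of unity.\<close>

lemma root_of_unity_power_root: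
  fixes c :: "'a::{field, finite}"
  assumes r: "prime r" "\<not> r dvd (CARD('a) - 1) div gcd n (CARD('a) - 1)" "r dvd CARD('a) - 1"
    and c: "c ^ n = 1" "c = b ^ r" "c \<noteq> 0"
  obtains b' where "b' ^ n = 1" "c = b' ^ r"
proof -
  obtain g :: 'a where g: "g \<noteq> 0" "\<And>x. x \<noteq> 0 \<Longrightarrow> \<exists>k::nat. x = g ^ k"
    "\<And>k::nat. g ^ k = 1 \<longleftrightarrow> (CARD('a) - 1) dvd k"
    by (rule finite_field_generator) blast
  define e where "e = (CARD('a) - 1) div gcd n (CARD('a) - 1)"
  have b0: "b \<noteq> 0" using c prime_gt_0_nat[OF r(1)] by auto
  obtain k where k: "b = g ^ k" using g(2)[OF b0] by blast
  have "e dvd k * r"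
    using root_of_unity_exponent[OF c(3) _ g(3), of "k * r" n] c by (simp add: k e_def power_mult)
  moreover have "coprime e r"
    using r(1,2) by (simp add: e_def prime_imp_coprime_nat coprime_commute)
  ultimately have "e dvd k" by (simp add: coprime_dvd_mult_left_iff)
  then show thesis
    using that[of b] root_of_unity_exponent[OF b0 k g(3), of n] c(2) by (simp add: e_def)
qed

section \<open>Shears and normal subgroups of the special linear group\<close>

definition dotp :: "'a::field ^ 'n \<Rightarrow> 'a ^ 'n \<Rightarrow> 'a" where
  "dotp f x = (\<Sum>k\<in>UNIV. f $ k * x $ k)"

text \<open>For \<open>dotp f u = 0\<close> this is the transvection along \<open>u\<close> with
  form \<open>f\<close>. Unlike \<open>transvection\<close>, it is not tied to coordinate
  directions, so its conjugates are easy to write down.\<close>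

definition shear :: "'a::field ^ 'n \<Rightarrow> 'a ^ 'n \<Rightarrow> 'a ^ 'n ^ 'n" where
  "shear u f = (\<chi> i j. (if i = j then 1 else 0) + u $ i * f $ j)"

lemma dotp_linear [simp]:
  "dotp f (x + y) = dotp f x + dotp f y" "dotp f (x - y) = dotp f x - dotp f y"
  "dotp f (c *s x) = c * dotp f x" "dotp (f + g) x = dotp f x + dotp g x" "dotp (- f) x = - dotp f x"
  "dotp (f - g) x = dotp f x - dotp g x"
  "dotp (c *s f) x = c * dotp f x" "dotp 0 x = 0"
  by (simp_all add: dotp_def algebra_simps sum.distrib sum_subtractf sum_distrib_left sum_negf)

lemma shear_mult_vec: "shear u f *v x = x + dotp f x *s u"
proof -
  have "(\<Sum>j\<in>UNIV. ((if i = j then 1 else 0) + u $ i * f $ j) * x $ j)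
     = (\<Sum>j\<in>UNIV. (if i = j then x $ j else 0) + (f $ j * x $ j) * u $ i)" for i
    by (intro sum.cong) (auto simp: algebra_simps)
  then show ?thesis
    by (simp add: shear_def dotp_def matrix_vector_mult_def vec_eq_iff sum.distrib sum_distrib_right)
qed

lemma shear_mult:
  "dotp f u = 0 \<Longrightarrow> shear u f ** shear u g = shear u (f + (g :: 'a::field ^ 'n))"
  by (subst matrix_eq) (simp add: shear_mult_vec vec_eq_iff algebra_simps flip: matrix_vector_mul_assoc)

lemma shear_0: "shear u 0 = mat 1"
  by (simp add: shear_def mat_def vec_eq_iff)

lemma pow_SL_shear:
  assumes "dotp f u = 0"
  shows "shear u f [^]\<^bsub>SL\<^esub> (k::nat) = shear u (of_nat k *s f)"
proof (induction k)
  case (Suc k)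
  have "of_nat (Suc k) *s f = of_nat k *s f + f" by (simp add: vec_eq_iff algebra_simps)
  then show ?case using Suc assms by (simp only: nat_pow_Suc SL_simps) (simp add: shear_mult)
qed (simp add: shear_0)

lemma det_pow_SL: "det (A [^]\<^bsub>SL\<^esub> (k::nat)) = det A ^ k"
  by (induction k) (simp_all add: det_mul det_I mult.commute)

text \<open>The \<open>q\<close>-th power of the shear is trivial, and \<open>x ^ q = x\<close> for its determinant.\<close>

lemma det_shear:
  fixes u f :: "'a::{field, finite} ^ 'n"
  assumes "dotp f u = 0"
  shows "det (shear u f) = 1"
proof -
  have "shear u f [^]\<^bsub>SL\<^esub> CARD('a) = mat 1"
    by (simp add: pow_SL_shear[OF assms] of_nat_CARD_eq_0 shear_0)
  then have "det (shear u f) ^ CARD('a) = 1" by (metis det_pow_SL det_I)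
  then show ?thesis by (simp add: pow_card_eq_self)
qed

text \<open>The multiple of \<open>u\<close> that agrees with \<open>w\<close> at a coordinate i
  with \<open>u $ i \<noteq> 0\<close> must differ from \<open>w\<close> at some other coordinate
  j.\<close>

lemma exists_nonzero_minor:
  fixes u w :: "'a::field ^ 'n"
  assumes "u \<noteq> 0" "\<And>c. w \<noteq> c *s u"
  obtains i j where "u $ i * w $ j - u $ j * w $ i \<noteq> 0"
proof -
  obtain i where i: "u $ i \<noteq> 0" using assms(1) by (auto simp: vec_eq_iff)
  have "w \<noteq> (w $ i / u $ i) *s u" by (rule assms(2))
  then obtain j where "w $ j \<noteq> (w $ i / u $ i) * u $ j" by (auto simp: vec_eq_iff)
  then have "u $ i * w $ j - u $ j * w $ i \<noteq> 0" using i by (auto simp: field_simps)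
  then show thesis by (rule that)
qed

lemma exists_dotp_values:
  fixes u w :: "'a::field ^ 'n"
  assumes "u \<noteq> 0" "\<And>c. w \<noteq> c *s u"
  obtains f where "dotp f u = \<alpha>" "dotp f w = \<beta>"
proof -
  obtain i j where D: "u $ i * w $ j - u $ j * w $ i \<noteq> 0" using exists_nonzero_minor[OF assms] by blast
  then have ij: "i \<noteq> j" by auto
  define D where "D = u $ i * w $ j - u $ j * w $ i"
  \<comment> \<open>Cramer's rule for the two equations in the coordinates i and j, before division
    by the determinant \<open>D\<close>.\<close>
  define f where "f = (\<alpha> * w $ j - \<beta> * u $ j) *s axis i 1 + (\<beta> * u $ i - \<alpha> * w $ i) *s axis j (1 :: 'a)"
  have ax: "dotp (axis k 1) x = x $ k" for k and x :: "'a ^ 'n"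
    by (simp add: dotp_def axis_def if_distrib[of "\<lambda>x. x * _"] cong: if_cong)
  have "dotp f u = \<alpha> * D" "dotp f w = \<beta> * D"
    by (simp_all add: f_def ax) (simp_all add: D_def algebra_simps)
  then have "dotp (inverse D *s f) u = \<alpha>" "dotp (inverse D *s f) w = \<beta>"
    using D by (simp_all add: D_def[symmetric])
  then show thesis by (rule that)
qed

lemma exists_dotp_annihilator:
  fixes u w :: "'a::field ^ 'n"
  assumes "3 \<le> CARD('n)" "u \<noteq> 0" "\<And>c. w \<noteq> c *s u"
  obtains f y where "dotp f u = 0" "dotp f w = 0" "dotp f y \<noteq> 0"
proof -
  obtain i j where D: "u $ i * w $ j - u $ j * w $ i \<noteq> 0" using exists_nonzero_minor[OF assms(2,3)] by blast
  then have ij: "i \<noteq> j" by auto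
  have "\<not> UNIV \<subseteq> {i, j}" using assms(1) card_mono[of "{i, j}" "UNIV :: 'n set"] ij by auto
  then obtain k where k: "k \<noteq> i" "k \<noteq> j" by blast
  \<comment> \<open>the vector product of the restrictions of \<open>u\<close> and \<open>w\<close> to three coordinates\<close>
  define f where "f = (u $ j * w $ k - u $ k * w $ j) *s axis i 1 + (u $ k * w $ i - u $ i * w $ k) *s axis j 1
     + (u $ i * w $ j - u $ j * w $ i) *s axis k (1 :: 'a)"
  have ax: "dotp (axis k 1) x = x $ k" for k and x :: "'a ^ 'n"
    by (simp add: dotp_def axis_def if_distrib[of "\<lambda>x. x * _"] cong: if_cong)
  have "dotp f u = 0" "dotp f w = 0" by (simp_all add: f_def ax)
  moreover have "dotp f (axis k 1) \<noteq> 0" using D k by (simp add: f_def ax) (simp add: axis_def)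
  ultimately show thesis by (rule that)
qed

section \<open>Normal subgroups consisting of scalar matrices\<close>

lemma mat_mult_vec: "mat c *v x = c *s (x :: 'a::field ^ 'n)"
  by (simp add: vec_eq_iff matrix_vector_mult_def mat_def if_distrib[of "\<lambda>x. x * _"] cong: if_cong)

text \<open>The basis vectors make the matrix diagonal; the sum of two of them being an eigenvector
  forces their eigenvalues to agree.\<close>

lemma scalar_if_all_eigenvectors:
  fixes A :: "'a::field ^ 'n ^ 'n"
  assumes "\<And>u. u \<noteq> 0 \<Longrightarrow> \<exists>c. A *v u = c *s u"
  shows "\<exists>c. A = mat c"
proof -
  have "axis i (1 :: 'a) \<noteq> (0 :: 'a ^ 'n)" for i by (auto simp: axis_def vec_eq_iff)
  then have "\<forall>i. \<exists>c. A *v axis i 1 = c *s axis i 1" using assms by blast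
  then obtain c where c: "\<And>i. A *v axis i 1 = c i *s axis i 1" by metis
  have ent: "A $ k $ i = (if k = i then c i else 0)" for k i
  proof -
    have "A $ k $ i = (A *v axis i 1) $ k" 
      by (simp add: matrix_vector_mult_def axis_def if_distrib[of "\<lambda>x. _ * x"] cong: if_cong)
    also have "\<dots> = (if k = i then c i else 0)" by (simp only: c) (simp add: axis_def)
    finally show ?thesis .
  qed
  have eq: "c i = c j" for i j
  proof (cases "i = j")
    case False
    have "axis i 1 + axis j (1 :: 'a) \<noteq> (0 :: 'a ^ 'n)" using False by (auto simp: axis_def vec_eq_iff)
    then obtain d where "A *v (axis i 1 + axis j 1) = d *s (axis i 1 + axis j 1)" using assms by blast
    then have d: "c i *s axis i 1 + c j *s axis j 1 = d *s (axis i 1 + axis j (1 :: 'a)) " 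
      by (simp add: matrix_vector_right_distrib c)
    have "c i = d" using arg_cong[OF d, of "\<lambda>v. v $ i"] False by (simp add: axis_def)
    moreover have "c j = d" using arg_cong[OF d, of "\<lambda>v. v $ j"] False by (simp add: axis_def)
    ultimately show ?thesis by simp
  qed simp
  fix i0
  have "A = mat (c i0)" using eq[of _ i0] by (auto simp: vec_eq_iff mat_def ent)
  then show ?thesis by blast
qed

text \<open>If some power \<open>A ^ k\<close> fixes \<open>v\<close> and k is nonzero in the field,
  this formula forces \<open>w = 0\<close>.\<close>

lemma pow_SL_mult_vec:
  assumes "A *v v = v + w" "A *v w = w"
  shows "(A [^]\<^bsub>SL\<^esub> (k::nat)) *v v = v + of_nat k *s (w :: 'a::field ^ 'n)"
proof (induction k)
  case (Suc k)
  have "(A [^]\<^bsub>SL\<^esub> k) *v w = w"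
    by (induction k) (simp_all add: assms(2) flip: matrix_vector_mul_assoc)
  then show ?case
    using Suc by (simp add: assms(1) matrix_vector_right_distrib vec_eq_iff algebra_simps flip: matrix_vector_mul_assoc)
qed simp

text \<open>The element is t^(-1) m t m^(-1) for t = \<open>shear u f\<close>, which lies in
  \<open>M\<close> by normality. The conjugate m t m^(-1) sends z to z + f(m' z) w; applying t^(-1)
  then subtracts the value of f times u.\<close>

lemma shear_commutator:
  fixes m :: "'a::{field, finite} ^ 'n ^ 'n"
  assumes M: "M \<lhd> SL" and m: "m \<in> M" and f: "dotp f u = 0" and w: "w = m *v u"
  obtains x m' where "x \<in> M" "m' ** m = mat 1" "m ** m' = mat 1"
    "\<And>z. x *v z = z + dotp f (m' *v z) *s w - dotp f z *s u - (dotp f (m' *v z) * dotp f w) *s u"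
proof -
  interpret M: normal M "SL :: ('a ^ 'n ^ 'n) monoid" by (rule M)
  define m' where "m' = inv\<^bsub>SL\<^esub> m"
  have mc: "m \<in> carrier SL" using m M.subset by blast
  have m': "m' ** m = mat 1" "m ** m' = mat 1"
    using M.l_inv[OF mc] M.r_inv[OF mc] by (simp_all add: m'_def)
  define t where "t = shear u f"
  have tc: "t \<in> carrier SL" using det_shear[OF f] by (simp add: t_def)
  have "shear u (- f) ** t = mat 1" using shear_mult[of "- f" u f] f by (simp add: t_def shear_0)
  then have t': "inv\<^bsub>SL\<^esub> t = shear u (- f)"
    using M.inv_equality[of "shear u (- f)" t] tc det_shear[of "- f" u] f by simp
  define x where "x = shear u (- f) ** m ** t ** m'"
  have "inv\<^bsub>SL\<^esub> t \<otimes>\<^bsub>SL\<^esub> m \<otimes>\<^bsub>SL\<^esub> t \<otimes>\<^bsub>SL\<^esub> m' \<in> M"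
    unfolding m'_def
    by (intro subgroup.m_closed[OF M.subgroup_axioms] M.inv_op_closed1 subgroup.m_inv_closed[OF M.subgroup_axioms] m tc)
  then have "x \<in> M" by (simp add: x_def t')
  moreover have "x *v z = z + dotp f (m' *v z) *s w - dotp f z *s u - (dotp f (m' *v z) * dotp f w) *s u" for z
  proof -
    have mz: "m *v (m' *v z) = z" by (simp add: matrix_vector_mul_assoc m')
    show ?thesis
      by (simp add: mz x_def t_def w shear_mult_vec matrix_vector_right_distrib vector_scalar_commute
          vec_eq_iff algebra_simps flip: matrix_vector_mul_assoc)
  qed
  ultimately show thesis using m' by (intro that)
qed

text \<open>If \<open>m\<close> moves some \<open>u\<close> to an independent vector
  \<open>w\<close>, a commutator \<open>x\<close> of \<open>m\<close> with a suitable shear along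
  \<open>u\<close> gives a contradiction. In dimension at least 3, \<open>f\<close> can kill both
  \<open>u\<close> and \<open>w\<close>, which makes \<open>x\<close> unipotent, and then its r-th
  power being scalar forces \<open>x\<close> to be trivial. Otherwise all elements of
  \<open>M\<close> square to 1, which \<open>x\<close> is computed to violate.\<close>

lemma normal_subgroup_SL_scalar:
  fixes M :: "('a::{field, finite} ^ 'n ^ 'n) set"
  assumes M: "M \<lhd> SL" and r: "of_nat r \<noteq> (0 :: 'a)"
    and pow: "\<And>x. x \<in> M \<Longrightarrow> \<exists>c. x [^]\<^bsub>SL\<^esub> r = mat c"
    and cases: "3 \<le> CARD('n) \<or> (\<forall>x\<in>M. x ** x = mat 1)"
    and m: "m \<in> M"
  shows "\<exists>c. m = mat c"
proof (rule scalar_if_all_eigenvectors, rule ccontr)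
  fix u assume u: "u \<noteq> 0" "\<nexists>c. m *v u = c *s u"
  define w where "w = m *v u"
  have w: "w \<noteq> c *s u" for c unfolding w_def using u(2) by blast
  have w0: "w \<noteq> 0" using w[of 0] by simp
  from cases show False
  proof
    assume "3 \<le> CARD('n)"
    then obtain f y where f: "dotp f u = 0" "dotp f w = 0" "dotp f y \<noteq> 0"
      using exists_dotp_annihilator[OF _ u(1) w] by metis
    obtain x m' where x: "x \<in> M" "m' ** m = mat 1"
      "\<And>z. x *v z = z + dotp f (m' *v z) *s w - dotp f z *s u - (dotp f (m' *v z) * dotp f w) *s u"
      using shear_commutator[OF M m f(1) w_def] by metis
    have "m' *v w = u" by (simp add: w_def matrix_vector_mul_assoc x(2))
    then have xw: "x *v w = w" by (simp add: x(3) f)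
    obtain c where c: "x [^]\<^bsub>SL\<^esub> r = mat c" using pow[OF x(1)] by blast
    \<comment> \<open>The scalar \<open>x ^ r\<close> can be read off at the fixed vector
      \<open>w\<close>.\<close>
    have "c *s w = w" using pow_SL_mult_vec[of x w 0 r] xw by (simp add: c mat_mult_vec)
    then have "c *s w = 1 *s w" by simp
    then have c1: "c = 1" using w0 by (metis vector_mul_rcancel)
    have fixed: "v = 0" if "x *v z = z + v" "x *v v = v" for z v
      using pow_SL_mult_vec[OF that, of r] r by (simp add: c c1)
    \<comment> \<open>The vectors are treated in this order because \<open>fixed\<close> needs a
      displacement that \<open>x\<close> already fixes: that of \<open>u\<close> is a multiple of
      \<open>w\<close>, and that of \<open>y\<close> is a combination of \<open>w\<close> and
      \<open>u\<close>.\<close>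
    have "dotp f (m' *v u) *s w = 0"
      by (rule fixed[of u]) (simp add: x(3) f, simp only: vector_scalar_commute xw)
    then have xu: "x *v u = u" by (simp add: x(3) f)
    have "dotp f (m' *v y) *s w - dotp f y *s u = 0"
      by (rule fixed[of y]) (simp add: x(3) f, simp only: matrix_vector_mult_diff_distrib vector_scalar_commute xw xu)
    then have "dotp f (m' *v y) *s w = dotp f y *s u" by simp
    moreover from this have "dotp f (m' *v y) \<noteq> 0" using f(3) u(1) by auto
    ultimately have "w = inverse (dotp f (m' *v y)) *s (dotp f y *s u)" by (metis vec.scale_scale left_inverse vec.scale_one)
    then show False using w by simp
  next
    assume inv: "\<forall>x\<in>M. x ** x = mat 1"
    \<comment> \<open>With these values and m' = m, \<open>x\<close> sends w to w - u and u to w, so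
      its square sends w to -u.\<close>
    obtain f where f: "dotp f u = 0" "dotp f w = 1"
      using exists_dotp_values[OF u(1) w] by metis
    obtain x m' where x: "x \<in> M" "m' ** m = mat 1"
      "\<And>z. x *v z = z + dotp f (m' *v z) *s w - dotp f z *s u - (dotp f (m' *v z) * dotp f w) *s u"
      using shear_commutator[OF M m f(1) w_def] by metis
    have mm: "m ** m = mat 1" using inv m by blast
    have "m' = m' ** (m ** m)" by (simp add: mm)
    also have "\<dots> = m" by (simp add: matrix_mul_assoc x(2))
    finally have m': "m' = m" .
    have "m *v w = u" by (simp add: w_def matrix_vector_mul_assoc mm)
    then have "x *v w = w - u" "x *v u = w"
      by (simp_all add: x(3) m' f w_def[symmetric])
    then have "(x ** x) *v w = - u"
      by (simp add: matrix_vector_mult_diff_distrib flip: matrix_vector_mul_assoc)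
    moreover have "x ** x = mat 1" using inv x(1) by blast
    ultimately show False using w[of "-1"] by simp
  qed
qed

text \<open>If f takes the value 1 at both \<open>u\<close> and \<open>w\<close>, it vanishes on
  \<open>w - u\<close>, so the shear along \<open>w - u\<close> has determinant 1 and maps
  \<open>u\<close> to \<open>w\<close>.\<close>

lemma SL_moves_vector:
  fixes u w :: "'a::{field, finite} ^ 'n"
  assumes "u \<noteq> 0" "\<And>c. w \<noteq> c *s u"
  obtains A where "det A = 1" "A *v u = w"
proof -
  obtain f where f: "dotp f u = 1" "dotp f w = 1" using exists_dotp_values[OF assms] by metis
  then have "det (shear (w - u) f) = 1" "shear (w - u) f *v u = w"
    by (simp_all add: det_shear shear_mult_vec)
  then show thesis by (rule that)
qed

section \<open>Eigenvectors and indices\<close>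

lemma pow_SL_Suc_mult_vec:
  assumes "det C = 1"
  shows "C *v ((C [^]\<^bsub>SL\<^esub> (k::nat)) *v x) = (C [^]\<^bsub>SL\<^esub> Suc k) *v (x :: 'a::field ^ 'n)"
proof -
  interpret group "SL :: ('a ^ 'n ^ 'n) monoid" by (rule group_SL)
  have "C \<in> carrier SL" using assms by simp
  then show ?thesis using nat_pow_Suc2[of C k] by (simp add: matrix_vector_mul_assoc)
qed

lemma matrix_vector_mult_sum_right:
  "A *v (\<Sum>j\<in>S. f j) = (\<Sum>j\<in>S. A *v (f j :: 'a::field ^ 'n))"
  by (induction S rule: infinite_finite_induct) (simp_all add: matrix_vector_right_distrib)

text \<open>
  For each \<open>r\<close>-th root \<open>b\<close> of \<open>a ^ r\<close>, the vector \<open>y b\<close> below satisfies \<open>C *v y b = b *s y b\<close>. It is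
  a polynomial of degree less than \<open>r\<close> in \<open>b\<close> with leading coefficient \<open>x\<close>, so it cannot vanish at all
  \<open>r\<close> roots.
\<close>

lemma power_scalar_imp_eigenvector:
  fixes C :: "'a::{field, finite} ^ 'n ^ 'n"
  assumes C: "det C = 1" "C [^]\<^bsub>SL\<^esub> r = mat (a ^ r)" and a: "a \<noteq> 0" and r: "r dvd CARD('a) - 1" "r > 0"
  obtains b y where "y \<noteq> 0" "C *v y = b *s y"
proof -
  \<comment> \<open>Every coordinate of this vector is nonzero, so the leading coefficient of
    \<open>p\<close> below is nonzero whichever index \<open>k\<close> is taken.\<close>
  define x :: "'a ^ 'n" where "x = 1"
  define h where "h = (\<lambda>b j. b ^ j *s ((C [^]\<^bsub>SL\<^esub> (r - j)) *v x))"
  define y where "y = (\<lambda>b. \<Sum>j<r. b ^ j *s ((C [^]\<^bsub>SL\<^esub> (r - 1 - j)) *v x))"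
  have eig: "C *v y b = b *s y b" if b: "b ^ r = a ^ r" for b
  proof -
    have "C *v y b = (\<Sum>j<r. h b j)"
      unfolding y_def h_def matrix_vector_mult_sum_right
    proof (rule sum.cong)
      fix j assume "j \<in> {..<r}"
      then have "Suc (r - 1 - j) = r - j" by simp
      then show "C *v (b ^ j *s ((C [^]\<^bsub>SL\<^esub> (r - 1 - j)) *v x)) = b ^ j *s ((C [^]\<^bsub>SL\<^esub> (r - j)) *v x)"
        using pow_SL_Suc_mult_vec[OF C(1), of "r - 1 - j" x] by (simp only: vector_scalar_commute)
    qed simp
    moreover have "b *s y b = (\<Sum>j<r. h b (Suc j))"
      by (simp add: y_def h_def vec.scale_sum_right)
    \<comment> \<open>The two sums differ by an index shift; what remains is \<open>C ^ r\<close>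
      applied to x minus \<open>b ^ r\<close> times x.\<close>
    ultimately have "C *v y b - b *s y b = h b 0 - h b r"
      by (simp only: sum_subtractf[symmetric] sum_lessThan_telescope')
    also have "\<dots> = 0" by (simp add: h_def C(2) mat_mult_vec b)
    finally show ?thesis by simp
  qed
  show thesis
  proof (cases "\<exists>b. b ^ r = a ^ r \<and> y b \<noteq> 0")
    case True
    then show thesis using eig that by blast
  next
    case False
    fix k :: 'n
    define p where "p = (\<Sum>j<r. Polynomial.monom (((C [^]\<^bsub>SL\<^esub> (r - 1 - j)) *v x) $ k) j)"
    have "poly p b = y b $ k" for b
      by (simp add: p_def y_def poly_sum poly_monom mult.commute)
    then have roots: "{b. b ^ r = a ^ r} \<subseteq> {b. poly p b = 0}" using False by auto
    have "Polynomial.coeff p (r - 1) = (\<Sum>j<r. if j = r - 1 then ((C [^]\<^bsub>SL\<^esub> (r - 1 - j)) *v x) $ k else 0)"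
      by (simp add: p_def coeff_sum)
    also have "\<dots> = x $ k" using r(2) by simp
    finally have "p \<noteq> 0" by (auto simp: x_def)
    moreover have "Polynomial.degree p \<le> r - 1" unfolding p_def
      by (intro degree_sum_le) (auto intro: order_trans[OF degree_monom_le])
    ultimately have "card {b. poly p b = 0} < r"
      using card_poly_roots_bound[of p] r(2) by simp
    moreover have "r \<le> card {b. poly p b = 0}"
      using card_mono[OF _ roots] card_roots_of_power[OF a r(1)] by simp
    ultimately show thesis by simp
  qed
qed

section \<open>Scalar matrices, central subgroups of prime index, and a counting argument\<close>

lemma mat_mult_mat: "mat a ** mat b = (mat (a * b) :: 'a::field ^ 'n ^ 'n)"
  by (subst matrix_eq) (simp add: mat_mult_vec flip: matrix_vector_mul_assoc)

lemma pow_SL_mat: "mat c [^]\<^bsub>SL\<^esub> (k::nat) = (mat (c ^ k) :: 'a::field ^ 'n ^ 'n)"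
  by (induction k) (simp_all add: mat_mult_mat mult.commute)

lemma det_mat: "det (mat c :: 'a::field ^ 'n ^ 'n) = c ^ CARD('n)"
  by (subst det_diagonal) (auto simp: mat_def)

lemma mat_in_group_center_SL:
  "(mat c :: 'a::field ^ 'n ^ 'n) \<in> group_center SL \<longleftrightarrow> c ^ CARD('n) = 1"
proof -
  have "A ** mat c = mat c ** A" for A :: "'a ^ 'n ^ 'n"
    by (subst matrix_eq) (simp add: mat_mult_vec vector_scalar_commute flip: matrix_vector_mul_assoc)
  then show ?thesis by (simp add: group_center_def det_mat)
qed

text \<open>These are the forms in which the index hypothesis on Z' is used. Properness comes from r
  > 1, and the last claim from the fact that the quotient of the center by \<open>N\<close> has
  order r.\<close>

lemma (in group) central_index_prime:
  assumes N: "subgroup N (G\<lparr>carrier := group_center G\<rparr>)" and r: "prime r"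
    and card: "card (rcosets\<^bsub>G\<lparr>carrier := group_center G\<rparr>\<^esub> N) = r"
  shows "N \<subset> group_center G" "subgroup N G" "card N * r = card (group_center G)"
    "z \<in> group_center G \<Longrightarrow> z [^] r \<in> N"
proof -
  let ?Z = "group_center G"
  let ?ZG = "G\<lparr>carrier := ?Z\<rparr>"
  interpret Z: group ?ZG by (rule subgroup_imp_group[OF subgroup_group_center])
  interpret Zc: comm_group ?ZG
    by (rule Z.group_comm_groupI) (auto dest: group_centerD)
  have "N \<lhd> ?ZG" using Zc.normal_iff_subgroup N by blast
  then interpret N: normal N ?ZG .
  interpret Q: group "?ZG Mod N" by (rule N.factorgroup_is_group)
  interpret p: group_hom ?ZG "?ZG Mod N" "\<lambda>z. N #>\<^bsub>?ZG\<^esub> z"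
    by unfold_locales (rule N.r_coset_hom_Mod)
  have sub: "N \<subseteq> ?Z" using N.subset by simp
  show "subgroup N G" using N incl_subgroup[OF subgroup_group_center] by blast
  show c: "card N * r = card ?Z" using Z.lagrange[OF N] card by (simp add: order_def mult.commute)
  have "N \<noteq> ?Z"
  proof
    assume "N = ?Z"
    then have "N #>\<^bsub>?ZG\<^esub> z = N" if "z \<in> ?Z" for z
      using Z.coset_join2[OF _ N] that by simp
    then have "rcosets\<^bsub>?ZG\<^esub> N \<subseteq> {N}" by (auto simp: RCOSETS_def)
    then have "r \<le> 1" using card_mono[of "{N}" "rcosets\<^bsub>?ZG\<^esub> N"] card by simp
    then show False using prime_gt_1_nat[OF r] by simp
  qed
  then show "N \<subset> ?Z" using sub by blast
  show "z [^] r \<in> N" if z: "z \<in> ?Z"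
  proof -
    have zc: "z \<in> carrier ?ZG" using z by simp
    have "N #>\<^bsub>?ZG\<^esub> (z [^]\<^bsub>?ZG\<^esub> r) = (N #>\<^bsub>?ZG\<^esub> z) [^]\<^bsub>?ZG Mod N\<^esub> order (?ZG Mod N)"
      using p.hom_nat_pow[OF zc, of r] card by (simp add: order_def FactGroup_def)
    also have "\<dots> = \<one>\<^bsub>?ZG Mod N\<^esub>" by (rule Q.pow_order_eq_1) (rule p.hom_closed[OF zc])
    finally have "N #>\<^bsub>?ZG\<^esub> (z [^]\<^bsub>?ZG\<^esub> r) = N" by (simp add: FactGroup_def)
    moreover have "z [^]\<^bsub>?ZG\<^esub> r \<in> carrier ?ZG" using zc by (rule Z.nat_pow_closed)
    ultimately have "z [^]\<^bsub>?ZG\<^esub> r \<in> N" using Z.coset_join1[OF _ _ N] N.subset by blast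
    then show ?thesis by (simp add: nat_pow_def)
  qed
qed

text \<open>The image has as many elements as there are cosets of the kernel. A kernel properly
  inside \<open>Z\<close> would have more cosets than \<open>H\<close> has elements.\<close>

lemma (in group_hom) kernel_le_imp_onto:
  assumes fin: "finite (carrier G)" and Z: "Z \<lhd> G" and le: "kernel G H h \<subseteq> Z" and H: "card (carrier H) = card (rcosets Z)"
  shows "kernel G H h = Z" "h ` carrier G = carrier H"
proof -
  \<comment> \<open>\<open>?t\<close> is the injection of the quotient by the kernel into
    \<open>H\<close> induced by \<open>h\<close>.\<close>
  let ?K = "kernel G H h" and ?t = "\<lambda>X. the_elem (h ` X)"
  interpret Z: normal Z G by (rule Z)
  have cQ: "carrier (G Mod ?K) = rcosets ?K" by (simp add: FactGroup_def)
  have "order G = card (rcosets Z) * card Z" using G.lagrange[OF Z.subgroup_axioms] by simp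
  then have "card (carrier H) > 0" using fin using G.order_gt_0_iff_finite by (metis H gr0I mult_is_0 not_gr_zero)
  then have finH: "finite (carrier H)" by (rule card_ge_0_finite)
  have sub: "?t ` (rcosets ?K) \<subseteq> carrier H" using FactGroup_the_elem_mem cQ by blast
  have inj: "inj_on ?t (rcosets ?K)" using FactGroup_inj_on cQ by simp
  have le2: "card (rcosets ?K) \<le> card (carrier H)"
    using card_mono[OF finH sub] card_image[OF inj] by simp
  have lag: "card (rcosets ?K) * card ?K = order G" "card (rcosets Z) * card Z = order G"
    by (rule G.lagrange[OF subgroup_kernel], rule G.lagrange[OF Z.subgroup_axioms])
  have finZ: "finite Z" using fin Z.subset finite_subset by blast
  have pos: "order G > 0" using fin by (simp add: G.order_gt_0_iff_finite)
  have "card (rcosets Z) * card Z \<le> card (rcosets Z) * card ?K"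
    using lag le2 by (metis H mult_le_mono1)
  moreover have "card (rcosets Z) > 0" using lag(2) pos by (metis gr0I mult_0 less_irrefl)
  ultimately have "card Z \<le> card ?K" by (metis mult_le_cancel1)
  then show K: "?K = Z" using card_seteq[OF finZ le] by blast
  have "?t ` (rcosets ?K) = carrier H"
    by (rule card_subset_eq[OF finH sub]) (simp add: card_image[OF inj], simp add: K H)
  moreover have "?t ` (rcosets ?K) \<subseteq> h ` carrier G"
  proof clarify
    fix X assume "X \<in> rcosets ?K"
    then obtain x where x: "x \<in> carrier G" "X = ?K #> x" by (auto simp: RCOSETS_def)
    have "x \<in> X" using x G.rcos_self subgroup_kernel by blast
    moreover have "h y = h x" if "y \<in> X" for y using that x by (auto simp: r_coset_def kernel_def)
    ultimately have "h ` X = {h x}" by blast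
    then show "?t X \<in> h ` carrier G" using x(1) by simp
  qed
  ultimately show "h ` carrier G = carrier H" by auto
qed

section \<open>Wreath products and the action on points\<close>

lemma permutation_wreath_product_simps:
  "carrier (permutation_wreath_product A G \<Omega> \<rho>) = (\<Omega> \<rightarrow>\<^sub>E carrier A) \<times> carrier G"
  "x \<otimes>\<^bsub>permutation_wreath_product A G \<Omega> \<rho>\<^esub> y
     = ((\<lambda>\<omega>\<in>\<Omega>. fst x \<omega> \<otimes>\<^bsub>A\<^esub> fst y (\<rho> (inv\<^bsub>G\<^esub> (snd x)) \<omega>)), snd x \<otimes>\<^bsub>G\<^esub> snd y)"
  "\<one>\<^bsub>permutation_wreath_product A G \<Omega> \<rho>\<^esub> = ((\<lambda>\<omega>\<in>\<Omega>. \<one>\<^bsub>A\<^esub>), \<one>\<^bsub>G\<^esub>)"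
  by (cases x; cases y; auto simp: permutation_wreath_product_def semidirect_product_def
      permutation_module_action_def restrict_def)+

lemma (in group_action) inv_fixes:
  assumes "g \<in> carrier G" "x \<in> E" "\<phi> g x = x"
  shows "\<phi> (inv g) x = x"
  using orbit_sym_aux[OF assms] by simp

text \<open>At a point fixed by the permutation part, wreath multiplication of powers of x does not
  move the coordinate, so values simply multiply. In the cyclic group of order r, an r-th power
  therefore has trivial value at such a point.\<close>

lemma wreath_pow_fixed_point:
  fixes A :: "('b, 'l) monoid_scheme" and G :: "('g, 'm) monoid_scheme" and \<Omega> :: "'w set" and \<rho> :: "'g \<Rightarrow> 'w \<Rightarrow> 'w"
  defines "W \<equiv> permutation_wreath_product A G \<Omega> \<rho>"
  assumes "group_action G \<Omega> \<rho>" "x \<in> carrier W" "\<omega> \<in> \<Omega>" "\<rho> (snd x) \<omega> = \<omega>"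
  shows "snd (x [^]\<^bsub>W\<^esub> (k::nat)) = snd x [^]\<^bsub>G\<^esub> k" "fst (x [^]\<^bsub>W\<^esub> k) \<omega> = fst x \<omega> [^]\<^bsub>A\<^esub> k"
proof -
  interpret group_action G \<Omega> \<rho> by fact
  interpret G: group G using group_hom by (simp add: group_hom_def)
  have g: "snd x \<in> carrier G" using assms(3) by (auto simp: W_def permutation_wreath_product_simps)
  have fixed: "\<rho> (snd x [^]\<^bsub>G\<^esub> k) \<omega> = \<omega>" for k :: nat
  proof (induction k)
    case 0
    show ?case using id_eq_one assms(4) by (simp flip: id_eq_one)
  next
    case (Suc k)
    then show ?case using composition_rule[OF assms(4) G.nat_pow_closed[OF g] g, of k] assms(5) by simp
  qed
  have "snd (x [^]\<^bsub>W\<^esub> k) = snd x [^]\<^bsub>G\<^esub> k \<and> fst (x [^]\<^bsub>W\<^esub> k) \<omega> = fst x \<omega> [^]\<^bsub>A\<^esub> k"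
  proof (induction k)
    case 0
    show ?case using assms(4) by (simp add: W_def permutation_wreath_product_simps)
  next
    case (Suc k)
    have "\<rho> (inv\<^bsub>G\<^esub> (snd x [^]\<^bsub>G\<^esub> k)) \<omega> = \<omega>"
      using inv_fixes[OF G.nat_pow_closed[OF g] assms(4) fixed] .
    then show ?case using Suc assms(4) by (simp add: W_def permutation_wreath_product_simps)
  qed
  then show "snd (x [^]\<^bsub>W\<^esub> (k::nat)) = snd x [^]\<^bsub>G\<^esub> k" "fst (x [^]\<^bsub>W\<^esub> k) \<omega> = fst x \<omega> [^]\<^bsub>A\<^esub> k" by auto
qed

section \<open>Diagonal matrices and transitivity on points\<close>

lemma diag_mult_diag:
  "(\<chi> i j. if i = j then d i else 0) ** (\<chi> i j. if i = j then e i else 0)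
    = (\<chi> i j. if i = j then d i * (e i :: 'a::field) else 0)"
  by (auto simp: matrix_matrix_mult_def vec_eq_iff if_distrib[of "\<lambda>x. x * _"] cong: if_cong)

lemma pow_SL_diag:
  "(\<chi> i j. if i = j then d i else 0) [^]\<^bsub>SL\<^esub> (k::nat) = (\<chi> i j. if i = j then d i ^ k else (0 :: 'a::field))"
proof (induction k)
  case (Suc k)
  then show ?case by (simp add: diag_mult_diag) (simp add: mult.commute cong: if_cong)
qed (simp add: mat_def cong: if_cong)

text \<open>The matrix is diagonal with \<open>a\<close> everywhere except at one index
  \<open>k\<close>, where the entry makes the determinant 1. The r-th power of that entry is still
  \<open>a ^ r\<close> because \<open>a ^ r\<close> is an n-th root of unity.\<close>

lemma power_scalar_in_SL:
  fixes a :: "'a::field"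
  assumes "a \<noteq> 0" "(a ^ r) ^ CARD('n) = 1"
  obtains A :: "'a ^ 'n ^ 'n" where "det A = 1" "A [^]\<^bsub>SL\<^esub> r = mat (a ^ r)"
proof -
  fix k :: 'n
  define m where "m = card (UNIV - {k})"
  define d where "d = (\<lambda>i. if i = k then inverse a ^ m else a)"
  let ?A = "(\<chi> i j. if i = j then d i else 0) :: 'a ^ 'n ^ 'n"
  have "CARD('n) = Suc m" by (simp add: m_def card_Diff_singleton)
  then have z: "a ^ r * (a ^ r) ^ m = 1" using assms(2) by simp
  have "det ?A = (\<Prod>i\<in>UNIV. d i)" by (subst det_diagonal) simp_all
  also have "\<dots> = d k * (\<Prod>i\<in>UNIV - {k}. d i)" by (rule prod.remove) simp_all
  also have "(\<Prod>i\<in>UNIV - {k}. d i) = a ^ m" by (simp add: d_def m_def)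
  finally have "det ?A = 1" using assms(1) by (simp add: d_def flip: power_mult_distrib)
  moreover have "d i ^ r = a ^ r" for i
  proof (cases "i = k")
    case True
    have "(inverse a ^ m) ^ r = inverse ((a ^ r) ^ m)"
      by (simp add: power_inverse power_mult[symmetric] mult.commute)
    also have "\<dots> = a ^ r" using z by (metis inverse_unique mult.commute)
    finally show ?thesis using True by (simp add: d_def)
  qed (simp add: d_def)
  then have "?A [^]\<^bsub>SL\<^esub> r = mat (a ^ r)" by (simp only: pow_SL_diag mat_def)
  ultimately show thesis by (rule that)
qed

lemma image_span_singleton:
  "(\<lambda>v. A *v v) ` vec.span {x} = vec.span {(A :: 'a::field ^ 'n ^ 'n) *v x}"
  using vec.linear_span_image[OF matrix_vector_mul_linear_gen, of A "{x}"] by simp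

lemma span_singleton_scale:
  "c \<noteq> 0 \<Longrightarrow> vec.span {c *s x} = vec.span {x :: 'a::field ^ 'n}"
  using vec.span_image_scale[of "{x}" "\<lambda>_. c"] by simp

lemma mult_vec_eq_0_iff_det_1:
  "det A = 1 \<Longrightarrow> A *v x = 0 \<longleftrightarrow> x = (0 :: 'a::field ^ 'n)"
  by (metis invertible_def invertible_det_nz matrix_vector_mul_assoc matrix_vector_mul_lid
      matrix_vector_mult_0_right zero_neq_one)

lemma SL_transitive_proj_points:
  fixes x y :: "('a::{field, finite} ^ 'n) set"
  assumes "x \<in> proj_points" "y \<in> proj_points"
  obtains A where "det A = 1" "(\<lambda>v. A *v v) ` x = y"
proof -
  obtain u w where u: "u \<noteq> 0" "x = vec.span {u}" and w: "w \<noteq> 0" "y = vec.span {w}"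
    using assms by (auto simp: proj_points_iff)
  show thesis
  proof (cases "\<exists>c. w = c *s u")
    case True
    then obtain c where c: "w = c *s u" by blast
    then have "c \<noteq> 0" using w(1) by auto
    then have "x = y" using u(2) w(2) c span_singleton_scale by metis
    then show thesis using that[of "mat 1"] by (simp add: det_I)
  next
    case False
    then obtain A where "det A = 1" "A *v u = w" using SL_moves_vector[OF u(1)] by metis
    then show thesis using that[of A] u(2) w(2) by (simp add: image_span_singleton)
  qed
qed

section \<open>The obstruction\<close>

lemma carrier_PSL: "carrier PSL = (\<lambda>A. group_center SL #>\<^bsub>SL\<^esub> A) ` {A. det A = 1}"
  by (auto simp: PSL_def carrier_FactGroup)

lemma group_center_normal_SL: "group_center (SL :: ('a::field ^ 'n ^ 'n) monoid) \<lhd> SL"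
  by (intro group.normal_of_le_center group.subgroup_group_center group_SL) auto

lemma group_hom_SL_PSL:
  "group_hom (SL :: ('a::field ^ 'n ^ 'n) monoid) PSL (\<lambda>A. group_center SL #>\<^bsub>SL\<^esub> A)"
  unfolding group_hom_def group_hom_axioms_def PSL_def
  using normal.r_coset_hom_Mod[OF group_center_normal_SL] group_SL group_PSL by (auto simp: PSL_def)

lemma one_PSL: "\<one>\<^bsub>PSL\<^esub> = group_center SL"
  by (simp add: PSL_def FactGroup_def)

lemma coset_center_SL_eq_one_iff:
  "det A = 1 \<Longrightarrow> group_center SL #>\<^bsub>SL\<^esub> A = \<one>\<^bsub>PSL\<^esub> \<longleftrightarrow> A \<in> group_center (SL :: ('a::field ^ 'n ^ 'n) monoid)"
  using group.coset_join1[OF group_SL, of "group_center SL" A] group.coset_join2[OF group_SL, of A "group_center SL"]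
    group.subgroup_group_center[OF group_SL] subgroup.subset[OF group.subgroup_group_center[OF group_SL]]
  unfolding one_PSL SL_simps by blast

lemma dvd_div_gcd_imp_dvd: "(r::nat) dvd m div gcd n m \<Longrightarrow> r dvd m"
  by (metis dvd_div_mult_self dvd_mult2 gcd_dvd2)

text \<open>Choose h mapping x to y. At the point y, commutation of (u, h) with (v, 1) reads u(y) +
  v(x) = v(y) + u(y). It is enough that each h occurs with a single u.\<close>

lemma wreath_center_constant:
  fixes v :: "('a::{field, finite} ^ 'n) set \<Rightarrow> int" and r :: nat
  defines "W \<equiv> permutation_wreath_product (integer_mod_group r) (PSL :: ('a ^ 'n ^ 'n) set monoid) proj_points proj_action"
  assumes v: "(v, \<one>\<^bsub>PSL\<^esub>) \<in> carrier W"
    and comm: "\<And>g. g \<in> carrier PSL \<Longrightarrow> \<exists>u. (u, g) \<in> carrier W \<and> (u, g) \<otimes>\<^bsub>W\<^esub> (v, \<one>\<^bsub>PSL\<^esub>) = (v, \<one>\<^bsub>PSL\<^esub>) \<otimes>\<^bsub>W\<^esub> (u, g)"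
    and "x \<in> proj_points" "y \<in> proj_points"
  shows "v x = v y"
proof -
  let ?Z = "integer_mod_group r"
  interpret act: group_action "PSL :: ('a ^ 'n ^ 'n) set monoid" proj_points proj_action
    by (rule group_action_proj)
  interpret G: group "PSL :: ('a ^ 'n ^ 'n) set monoid" by (rule group_PSL)
  interpret Z: comm_group ?Z by simp
  obtain A :: "'a ^ 'n ^ 'n" where A: "det A = 1" "(\<lambda>v. A *v v) ` x = y"
    using SL_transitive_proj_points assms(4,5) by metis
  define h :: "('a ^ 'n ^ 'n) set" where "h = group_center SL #>\<^bsub>SL\<^esub> A"
  have h: "h \<in> carrier PSL" using A(1) by (auto simp: h_def carrier_PSL)
  have hx: "proj_action h x = y" using proj_action_coset[OF A(1) assms(4)] A(2) by (simp add: h_def)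
  obtain u where u: "(u, h) \<in> carrier W" "(u, h) \<otimes>\<^bsub>W\<^esub> (v, \<one>\<^bsub>PSL\<^esub>) = (v, \<one>\<^bsub>PSL\<^esub>) \<otimes>\<^bsub>W\<^esub> (u, h)"
    using comm[OF h] by blast
  have vu: "v z \<in> carrier ?Z" "u z \<in> carrier ?Z" if "z \<in> proj_points" for z
    using v u(1) that by (auto simp: W_def permutation_wreath_product_simps)
  have inv_h: "proj_action (inv\<^bsub>PSL\<^esub> h) y = x"
    using act.orbit_sym_aux[OF h assms(4) hx] .
  have one: "proj_action \<one>\<^bsub>PSL\<^esub> y = y" using fun_cong[OF act.id_eq_one, of y] assms(5) by simp
  have "u y \<otimes>\<^bsub>?Z\<^esub> v x = v y \<otimes>\<^bsub>?Z\<^esub> u y"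
    using arg_cong[OF u(2), of "\<lambda>p. fst p y"] assms(5) inv_h one
    by (simp add: W_def permutation_wreath_product_simps del: mult_integer_mod_group)
  then have "u y \<otimes>\<^bsub>?Z\<^esub> v x = u y \<otimes>\<^bsub>?Z\<^esub> v y"
    using Z.m_comm[OF vu(1)[OF assms(5)] vu(2)[OF assms(5)]] by simp
  then show ?thesis using vu assms(4,5) by (metis Z.Units_eq Z.Units_l_cancel)
qed

text \<open>The r-th power of \<open>B\<close> is a scalar c with c^n = 1, and the divisibility
  assumption makes c an r-th power b^r. A line spanned by an eigenvector of \<open>B\<close> is the
  required point.\<close>

lemma fixed_point_of_power_central:
  fixes B :: "'a::{field, finite} ^ 'n ^ 'n"
  assumes B: "det B = 1" "B [^]\<^bsub>SL\<^esub> r \<in> group_center SL"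
    and r: "r > 0" "r dvd (CARD('a) - 1) div gcd CARD('n) (CARD('a) - 1)"
  obtains x where "x \<in> proj_points" "proj_action (group_center SL #>\<^bsub>SL\<^esub> B) x = x"
proof -
  obtain c where c: "B [^]\<^bsub>SL\<^esub> r = mat c" "c ^ CARD('n) = 1" using center_SL_scalar[OF B(2)] by blast
  have "c \<noteq> 0" using c(2) by (metis power_0_left zero_less_card_finite less_irrefl zero_neq_one)
  then obtain b where b: "b \<noteq> 0" "c = b ^ r" using root_of_unity_is_power[OF _ c(2) r(2)] by metis
  have "r dvd CARD('a) - 1"
    using dvd_div_gcd_imp_dvd[OF r(2)] .
  then obtain \<beta> y where y: "y \<noteq> 0" "B *v y = \<beta> *s y"
    using power_scalar_imp_eigenvector[OF B(1) _ b(1), of r] c(1) b(2) r(1) by metis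
  have "\<beta> \<noteq> 0" using y mult_vec_eq_0_iff_det_1[OF B(1), of y] by auto
  then have "(\<lambda>v. B *v v) ` vec.span {y} = vec.span {y}"
    by (simp add: image_span_singleton y(2) span_singleton_scale)
  moreover have "vec.span {y} \<in> proj_points" using y(1) by (auto simp: proj_points_iff)
  ultimately show thesis using that proj_action_coset[OF B(1)] by metis
qed

lemma no_embedding_of_quotient:
  fixes \<phi> :: "'a::{field, finite} ^ 'n ^ 'n \<Rightarrow> (('a ^ 'n) set \<Rightarrow> int) \<times> ('a ^ 'n ^ 'n) set" and r :: nat
  defines "W \<equiv> permutation_wreath_product (integer_mod_group r) (PSL :: ('a ^ 'n ^ 'n) set monoid) proj_points proj_action"
  assumes hom: "\<phi> \<in> hom SL W" and ker: "kernel SL W \<phi> = Z'"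
    and r: "prime r" "r dvd (CARD('a) - 1) div gcd CARD('n) (CARD('a) - 1)"
    and Z': "Z' \<subset> group_center SL"
    and n: "3 \<le> CARD('n) \<or> r = 2 \<and> Z' = {mat 1}"
  shows False
proof -
  let ?S = "SL :: ('a ^ 'n ^ 'n) monoid" and ?G = "PSL :: ('a ^ 'n ^ 'n) set monoid"
  let ?Z = "group_center ?S"
  have r0: "r > 0" using prime_gt_0_nat[OF r(1)] .
  have rq: "r dvd CARD('a) - 1"
    using dvd_div_gcd_imp_dvd[OF r(2)] .
  interpret S: group ?S by (rule group_SL)
  interpret G: group ?G by (rule group_PSL)
  have gW: "group W" unfolding W_def by (rule group_permutation_wreath_product) (simp_all add: group_action_proj)
  interpret W: group W by (rule gW)
  interpret \<phi>: group_hom ?S W \<phi> using hom by unfold_locales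
  interpret act: group_action ?G proj_points proj_action by (rule group_action_proj)
  \<comment> \<open>The permutation part of \<open>\<phi>\<close>. It need not be the natural
    projection to \<open>PSL\<close>; only its kernel and image will be determined.\<close>
  define p where "p = (\<lambda>A. snd (\<phi> A))"
  have "p \<in> hom ?S ?G"
  proof (rule homI)
    fix A assume "A \<in> carrier ?S"
    then have "\<phi> A \<in> carrier W" by (rule \<phi>.hom_closed)
    then show "p A \<in> carrier ?G" by (auto simp: p_def W_def permutation_wreath_product_simps)
  next
    fix A B assume "A \<in> carrier ?S" "B \<in> carrier ?S"
    then have "\<phi> (A \<otimes>\<^bsub>?S\<^esub> B) = \<phi> A \<otimes>\<^bsub>W\<^esub> \<phi> B" by (rule \<phi>.hom_mult)
    then show "p (A \<otimes>\<^bsub>?S\<^esub> B) = p A \<otimes>\<^bsub>?G\<^esub> p B" by (simp add: p_def W_def permutation_wreath_product_simps)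
  qed
  then interpret p: group_hom ?S ?G p by unfold_locales
  have fp: "fst (\<phi> x [^]\<^bsub>W\<^esub> r) \<omega> = 0"
    if "x \<in> carrier ?S" "\<omega> \<in> proj_points" "proj_action (p x) \<omega> = \<omega>" for x \<omega>
    using wreath_pow_fixed_point(2)[OF group_action_proj _ that(2), of "\<phi> x" "integer_mod_group r" r]
      \<phi>.hom_closed[OF that(1)] that(3)
    by (simp add: W_def p_def)
  \<comment> \<open>An element with trivial permutation part fixes every point, so its r-th power is
    trivial in \<open>W\<close> and lies in the kernel of \<open>\<phi>\<close>.\<close>
  have pow_ker: "x [^]\<^bsub>?S\<^esub> r \<in> Z'" if x: "x \<in> kernel ?S ?G p" for x
  proof -
    have xc: "x \<in> carrier ?S" "p x = \<one>\<^bsub>?G\<^esub>" using x by (auto simp: kernel_def)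
    have xrc: "x [^]\<^bsub>?S\<^esub> r \<in> carrier ?S" using xc(1) by (rule S.nat_pow_closed)
    have eq: "\<phi> (x [^]\<^bsub>?S\<^esub> r) = \<phi> x [^]\<^bsub>W\<^esub> r" using xc(1) by (rule \<phi>.hom_nat_pow)
    have "proj_action (p x) \<omega> = \<omega>" if "\<omega> \<in> proj_points" for \<omega>
      using fun_cong[OF act.id_eq_one, of \<omega>] that xc(2) by simp
    then have "fst (\<phi> (x [^]\<^bsub>?S\<^esub> r)) \<omega> = 0" if "\<omega> \<in> proj_points" for \<omega>
      using fp[OF xc(1) that] that eq by simp
    moreover have "fst (\<phi> (x [^]\<^bsub>?S\<^esub> r)) \<in> extensional proj_points"
      using \<phi>.hom_closed[OF xrc] by (auto simp: W_def permutation_wreath_product_simps PiE_def)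
    ultimately have "fst (\<phi> (x [^]\<^bsub>?S\<^esub> r)) = (\<lambda>\<omega>\<in>proj_points. 0)"
      by (intro extensionalityI[of _ proj_points]) auto
    moreover have "snd (\<phi> (x [^]\<^bsub>?S\<^esub> r)) = \<one>\<^bsub>?G\<^esub>"
      using p.hom_nat_pow[OF xc(1), of r] xc(2) by (simp add: p_def)
    ultimately have "\<phi> (x [^]\<^bsub>?S\<^esub> r) = \<one>\<^bsub>W\<^esub>"
      by (simp add: W_def permutation_wreath_product_simps prod_eq_iff)
    then show ?thesis using xrc ker by (auto simp: kernel_def)
  qed
  have "kernel ?S ?G p \<subseteq> ?Z"
  proof
    fix m assume m: "m \<in> kernel ?S ?G p"
    have "\<exists>c. m = mat c"
    proof (rule normal_subgroup_SL_scalar[OF p.normal_kernel of_nat_dvd_card_pred_neq_0[OF rq] _ _ m])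
      fix x assume "x \<in> kernel ?S ?G p"
      then have "x [^]\<^bsub>?S\<^esub> r \<in> ?Z" using pow_ker Z' by blast
      then show "\<exists>c. x [^]\<^bsub>?S\<^esub> r = mat c" using center_SL_scalar by metis
    next
      \<comment> \<open>In the remaining case r = 2 and Z' is trivial, so \<open>pow_ker\<close>
        says that squares are 1.\<close>
      show "3 \<le> CARD('n) \<or> (\<forall>x\<in>kernel ?S ?G p. x ** x = mat 1)"
        using n pow_ker by (auto simp: numeral_2_eq_2)
    qed
    moreover have "det m = 1" using m by (simp add: kernel_def)
    ultimately show "m \<in> ?Z" using mat_in_group_center_SL det_mat by metis
  qed
  moreover have "card (carrier ?G) = card (rcosets\<^bsub>?S\<^esub> ?Z)" by (simp add: PSL_def FactGroup_def)
  ultimately have kerp: "kernel ?S ?G p = ?Z" and onto: "p ` carrier ?S = carrier ?G"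
    using p.kernel_le_imp_onto[OF _ group_center_normal_SL] by (metis finite)+
  obtain \<zeta> where \<zeta>: "\<zeta> \<in> ?Z" "\<zeta> \<notin> Z'" using Z' by blast
  obtain z where z: "\<zeta> = mat z" "z ^ CARD('n) = 1" using center_SL_scalar[OF \<zeta>(1)] by blast
  have \<zeta>c: "\<zeta> \<in> carrier ?S" "p \<zeta> = \<one>\<^bsub>?G\<^esub>" using \<zeta>(1) kerp by (auto simp: kernel_def)
  define v where "v = fst (\<phi> \<zeta>)"
  have \<phi>\<zeta>: "\<phi> \<zeta> = (v, \<one>\<^bsub>?G\<^esub>)" using \<zeta>c(2) by (simp add: v_def p_def prod_eq_iff)
  have vW: "(v, \<one>\<^bsub>?G\<^esub>) \<in> carrier W" using \<phi>.hom_closed[OF \<zeta>c(1)] \<phi>\<zeta> by simp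
  have const: "v x = v y" if "x \<in> proj_points" "y \<in> proj_points" for x y
  proof (rule wreath_center_constant[OF vW[unfolded W_def] _ that, folded W_def])
    fix g assume "g \<in> carrier ?G"
    then obtain B where B: "B \<in> carrier ?S" "g = p B" using onto by blast
    have "B \<otimes>\<^bsub>?S\<^esub> \<zeta> = \<zeta> \<otimes>\<^bsub>?S\<^esub> B" using group_centerD(2)[OF \<zeta>(1) B(1)] .
    then have "\<phi> B \<otimes>\<^bsub>W\<^esub> \<phi> \<zeta> = \<phi> \<zeta> \<otimes>\<^bsub>W\<^esub> \<phi> B" using \<phi>.hom_mult B(1) \<zeta>c(1) by metis
    moreover have "\<phi> B = (fst (\<phi> B), g)" by (simp add: B(2) p_def)
    ultimately show "\<exists>u. (u, g) \<in> carrier W \<and> (u, g) \<otimes>\<^bsub>W\<^esub> (v, \<one>\<^bsub>?G\<^esub>) = (v, \<one>\<^bsub>?G\<^esub>) \<otimes>\<^bsub>W\<^esub> (u, g)"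
      using \<phi>.hom_closed[OF B(1)] \<phi>\<zeta> by metis
  qed
  have "z \<noteq> 0" using z(2) by (metis power_0_left zero_less_card_finite less_irrefl zero_neq_one)
  then obtain a where a: "a \<noteq> 0" "z = a ^ r" using root_of_unity_is_power[OF _ z(2) r(2)] by metis
  obtain A :: "'a ^ 'n ^ 'n" where A: "det A = 1" "A [^]\<^bsub>SL\<^esub> r = \<zeta>"
    using power_scalar_in_SL[OF a(1), of r] z a(2) by metis
  have Ac: "A \<in> carrier ?S" using A(1) by simp
  have "p A \<in> carrier ?G" using p.hom_closed[OF Ac] .
  \<comment> \<open>Fixed points of \<open>p A\<close> are found through a matrix \<open>B\<close>
    representing it, which may be unrelated to \<open>A\<close>. All that is known is that
    \<open>B ^ r\<close> is central, since \<open>p\<close> kills \<open>A ^ r\<close>.\<close>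
  then obtain B where B: "det B = 1" "p A = ?Z #>\<^bsub>?S\<^esub> B" unfolding carrier_PSL by blast
  have Bc: "B \<in> carrier ?S" using B(1) by simp
  have "?Z #>\<^bsub>?S\<^esub> (B [^]\<^bsub>?S\<^esub> r) = p A [^]\<^bsub>?G\<^esub> r"
    using group_hom.hom_nat_pow[OF group_hom_SL_PSL Bc] B(2) by simp
  also have "\<dots> = \<one>\<^bsub>?G\<^esub>" using p.hom_nat_pow[OF Ac, of r] A(2) \<zeta>c(2) by simp
  finally have "B [^]\<^bsub>?S\<^esub> r \<in> ?Z"
    using coset_center_SL_eq_one_iff[of "B [^]\<^bsub>?S\<^esub> r"] S.nat_pow_closed[OF Bc, of r] by simp
  then obtain \<omega> where \<omega>: "\<omega> \<in> proj_points" "proj_action (p A) \<omega> = \<omega>"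
    using fixed_point_of_power_central[OF B(1) _ r0 r(2)] B(2) by metis
  have "v \<omega> = 0" using fp[OF Ac \<omega>] \<phi>.hom_nat_pow[OF Ac, of r] A(2) by (simp add: v_def)
  then have "v x = 0" if "x \<in> proj_points" for x using const[OF that \<omega>(1)] by simp
  moreover have "v \<in> extensional proj_points"
    using vW by (auto simp: W_def permutation_wreath_product_simps PiE_def)
  ultimately have "v = (\<lambda>\<omega>\<in>proj_points. 0)"
    by (intro extensionalityI[of _ proj_points]) auto
  then have "\<phi> \<zeta> = \<one>\<^bsub>W\<^esub>" by (simp add: \<phi>\<zeta> W_def permutation_wreath_product_simps)
  then have "\<zeta> \<in> Z'" using \<zeta>c(1) ker by (auto simp: kernel_def)
  then show False using \<zeta>(2) by simp
qed

section \<open>The embedding\<close>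

text \<open>The injection is composed with h and the projection with the inverse k; composing a
  splitting of the new sequence with k would split the old one.\<close>

lemma nonsplit_central_extension_iso:
  assumes "nonsplit_central_extension r B G" "h \<in> iso B B'" "group B'"
  shows "nonsplit_central_extension r B' G"
proof -
  let ?R = "integer_mod_group r"
  obtain \<iota> \<pi> where ce: "central_extension ?R B G \<iota> \<pi>"
    and ns: "\<not> (\<exists>\<sigma> \<in> hom G B. \<forall>g \<in> carrier G. \<pi> (\<sigma> g) = g)"
    using assms(1) unfolding nonsplit_central_extension_def by blast
  have grp: "group ?R" "group B" "group G" and \<iota>: "\<iota> \<in> mon ?R B" and \<pi>: "\<pi> \<in> epi B G"
    and ker: "kernel B G \<pi> = \<iota> ` carrier ?R" and cent: "\<iota> ` carrier ?R \<subseteq> group_center B"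
    using ce by (auto simp: central_extension_def)
  define k where "k = inv_into (carrier B) h"
  have k: "k \<in> iso B' B" unfolding k_def using group.iso_set_sym[OF grp(2) assms(2)] .
  have hbij: "bij_betw h (carrier B) (carrier B')" "h \<in> hom B B'"
    and kbij: "bij_betw k (carrier B') (carrier B)" "k \<in> hom B' B"
    using assms(2) k by (auto simp: iso_def)
  have kh: "k (h b) = b" if "b \<in> carrier B" for b
    unfolding k_def by (rule bij_betw_inv_into_left[OF hbij(1) that])
  have hk: "h (k b) = b" if "b \<in> carrier B'" for b
    unfolding k_def by (rule bij_betw_inv_into_right[OF hbij(1) that])
  have hc: "h b \<in> carrier B'" if "b \<in> carrier B" for b using hom_in_carrier[OF hbij(2) that] .
  have kc: "k b \<in> carrier B" if "b \<in> carrier B'" for b using hom_in_carrier[OF kbij(2) that] .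
  have \<iota>c: "\<iota> ` carrier ?R \<subseteq> carrier B" using \<iota> by (auto simp: mon_def hom_def)
  have "h \<circ> \<iota> \<in> mon ?R B'"
  proof -
    have "inj_on \<iota> (carrier ?R)" "\<iota> \<in> hom ?R B" using \<iota> by (auto simp: mon_def)
    moreover have "inj_on h (\<iota> ` carrier ?R)"
      using bij_betw_imp_inj_on[OF hbij(1)] \<iota>c by (rule inj_on_subset)
    ultimately show ?thesis
      unfolding mon_def using comp_inj_on hom_compose[OF _ hbij(2)] by blast
  qed
  moreover have "\<pi> \<circ> k \<in> epi B' G"
  proof -
    have "(\<pi> \<circ> k) ` carrier B' = carrier G"
      using \<pi> bij_betw_imp_surj_on[OF kbij(1)]
      by (simp only: image_comp[symmetric] epi_def mem_Collect_eq)
    then show ?thesis using \<pi> kbij(2) using hom_compose[OF kbij(2), of \<pi> G] by (auto simp: epi_def)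
  qed
  moreover have "kernel B' G (\<pi> \<circ> k) = (h \<circ> \<iota>) ` carrier ?R"
  proof -
    have "kernel B' G (\<pi> \<circ> k) = h ` kernel B G \<pi>"
      using hc kc hk kh by (force simp: kernel_def image_iff)
    then show ?thesis by (simp add: ker image_comp)
  qed
  moreover have "(h \<circ> \<iota>) ` carrier ?R \<subseteq> group_center B'"
  proof clarsimp
    fix a assume a: "a \<in> carrier ?R"
    have z: "\<iota> a \<in> group_center B" using cent a by blast
    show "h (\<iota> a) \<in> group_center B'"
    proof (rule group_centerI)
      show "h (\<iota> a) \<in> carrier B'" using hc group_centerD(1)[OF z] by blast
      fix g assume g: "g \<in> carrier B'"
      have "h (k g \<otimes>\<^bsub>B\<^esub> \<iota> a) = h (\<iota> a \<otimes>\<^bsub>B\<^esub> k g)" using group_centerD(2)[OF z kc[OF g]] by simp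
      then show "g \<otimes>\<^bsub>B'\<^esub> h (\<iota> a) = h (\<iota> a) \<otimes>\<^bsub>B'\<^esub> g"
        using hom_mult[OF hbij(2)] kc[OF g] group_centerD(1)[OF z] hk[OF g] by metis
    qed
  qed
  ultimately have "central_extension ?R B' G (h \<circ> \<iota>) (\<pi> \<circ> k)"
    using grp assms(3) by (simp add: central_extension_def)
  moreover have "\<not> (\<exists>\<sigma> \<in> hom G B'. \<forall>g \<in> carrier G. (\<pi> \<circ> k) (\<sigma> g) = g)"
  proof
    assume "\<exists>\<sigma> \<in> hom G B'. \<forall>g \<in> carrier G. (\<pi> \<circ> k) (\<sigma> g) = g"
    then obtain \<sigma> where \<sigma>: "\<sigma> \<in> hom G B'" "\<And>g. g \<in> carrier G \<Longrightarrow> \<pi> (k (\<sigma> g)) = g" by auto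
    then have "k \<circ> \<sigma> \<in> hom G B" using kbij(2) hom_compose by blast
    then show False using ns \<sigma>(2) by auto
  qed
  ultimately show ?thesis unfolding nonsplit_central_extension_def by blast
qed

section \<open>The monomial action on representatives of the points\<close>

definition point_rep :: "('a::field ^ 'n) set \<Rightarrow> 'a ^ 'n" where
  "point_rep x = (SOME v. v \<noteq> 0 \<and> x = vec.span {v})"

lemma point_rep:
  assumes "x \<in> proj_points"
  shows "point_rep x \<noteq> 0" "x = vec.span {point_rep x}"
proof -
  have "point_rep x \<noteq> 0 \<and> x = vec.span {point_rep x}"
    unfolding point_rep_def by (rule someI_ex) (use assms proj_points_iff in blast)
  then show "point_rep x \<noteq> 0" "x = vec.span {point_rep x}" by auto
qed

text \<open>For \<open>A\<close> of determinant 1 and a point x this is the nonzero entry belonging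
  to x in the monomial action of \<open>A\<close>. It is unique because representatives of points
  are nonzero.\<close>

definition monomial_coeff :: "'a::field ^ 'n ^ 'n \<Rightarrow> ('a ^ 'n) set \<Rightarrow> 'a" where
  "monomial_coeff A x = (THE c. A *v point_rep x = c *s point_rep ((\<lambda>v. A *v v) ` x))"

lemma monomial_coeff_eqI:
  assumes "x \<in> proj_points" "det A = 1" "A *v point_rep x = c *s point_rep ((\<lambda>v. A *v v) ` x)"
  shows "monomial_coeff A x = c"
  unfolding monomial_coeff_def
  using assms point_rep(1)[OF image_proj_point[OF assms(1,2)]] by (intro the_equality) auto

lemma monomial_coeff:
  assumes "x \<in> proj_points" "det A = 1"
  shows "A *v point_rep x = monomial_coeff A x *s point_rep ((\<lambda>v. A *v v) ` x)" "monomial_coeff A x \<noteq> 0"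
proof -
  let ?y = "(\<lambda>v. A *v v) ` x"
  have "point_rep x \<in> x" using point_rep(2)[OF assms(1)] by (metis singletonI vec.span_base)
  then have "A *v point_rep x \<in> vec.span {point_rep ?y}"
    using point_rep(2)[OF image_proj_point[OF assms]] by blast
  then obtain c where c: "A *v point_rep x = c *s point_rep ?y"
    by (auto simp: vec.span_singleton)
  then show eq: "A *v point_rep x = monomial_coeff A x *s point_rep ?y"
    using monomial_coeff_eqI[OF assms c] by simp
  have "A *v point_rep x \<noteq> 0" using mult_vec_eq_0_iff_det_1[OF assms(2)] point_rep(1)[OF assms(1)] by blast
  then show "monomial_coeff A x \<noteq> 0" using eq by auto
qed

text \<open>The cocycle identity, obtained by applying \<open>B\<close> and then \<open>A\<close> to
  the representative of x.\<close>

lemma monomial_coeff_mult: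
  assumes x: "x \<in> proj_points" and A: "det A = 1" and B: "det B = 1"
  shows "monomial_coeff (A ** B) x = monomial_coeff A ((\<lambda>v. B *v v) ` x) * monomial_coeff B x"
proof (rule monomial_coeff_eqI[OF x])
  show "det (A ** B) = 1" by (simp add: det_mul A B)
  let ?y = "(\<lambda>v. B *v v) ` x"
  have "(A ** B) *v point_rep x = monomial_coeff B x *s (A *v point_rep ?y)"
    by (simp add: monomial_coeff(1)[OF x B] vector_scalar_commute flip: matrix_vector_mul_assoc)
  also have "\<dots> = (monomial_coeff A ?y * monomial_coeff B x) *s point_rep ((\<lambda>v. A *v v) ` ?y)"
    by (simp add: monomial_coeff(1)[OF image_proj_point[OF x B] A] mult.commute)
  also have "(\<lambda>v. A *v v) ` ?y = (\<lambda>v. (A ** B) *v v) ` x"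
    by (simp add: image_image matrix_vector_mul_assoc)
  finally show "(A ** B) *v point_rep x = (monomial_coeff A ?y * monomial_coeff B x) *s point_rep ((\<lambda>v. (A ** B) *v v) ` x)" .
qed

lemma mat_proj_point:
  fixes x :: "('a::field ^ 'n) set"
  assumes "x \<in> proj_points" "c \<noteq> 0"
  shows "(\<lambda>v. mat c *v v) ` x = x"
proof -
  have "x = vec.span {point_rep x}" using point_rep(2)[OF assms(1)] .
  then show ?thesis
    using image_span_singleton[of "mat c" "point_rep x"] span_singleton_scale[OF assms(2), of "point_rep x"]
    by (simp add: mat_mult_vec)
qed

lemma monomial_coeff_mat:
  assumes "x \<in> proj_points" "c ^ CARD('n) = 1"
  shows "monomial_coeff (mat c :: 'a::field ^ 'n ^ 'n) x = c"
proof -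
  have "c \<noteq> 0" using assms(2) by (metis power_0_left zero_less_card_finite less_irrefl zero_neq_one)
  show ?thesis
    by (rule monomial_coeff_eqI[OF assms(1)])
      (simp add: det_mat assms(2), simp only: mat_proj_point[OF assms(1) \<open>c \<noteq> 0\<close>], simp add: mat_mult_vec)
qed

text \<open>A central scalar in the kernel of \<open>L\<close> is an r-th power of a field element,
  and by the nondivisibility even of an n-th root of unity, so it lies in Z'. If Z' also contained z
  with L z nonzero, then L z would generate the integers modulo r, every central scalar could be
  multiplied by a power of z into the kernel of \<open>L\<close>, and Z' would be the whole
  center.\<close>

lemma subgroup_center_SL_eq:
  fixes L :: "'a::{field, finite} \<Rightarrow> int" and Z' :: "('a ^ 'n ^ 'n) set"
  assumes r: "prime r" "r dvd CARD('a) - 1" "\<not> r dvd (CARD('a) - 1) div gcd CARD('n) (CARD('a) - 1)"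
    and L: "\<And>x y. x \<noteq> 0 \<Longrightarrow> y \<noteq> 0 \<Longrightarrow> L (x * y) = (L x + L y) mod int r"
      "\<And>x. x \<noteq> 0 \<Longrightarrow> L x = 0 \<longleftrightarrow> (\<exists>y. y \<noteq> 0 \<and> x = y ^ r)" "\<And>x. L x \<in> {0..<int r}"
    and Z': "subgroup Z' SL" "Z' \<subset> group_center SL" "\<And>z. z \<in> group_center SL \<Longrightarrow> z [^]\<^bsub>SL\<^esub> r \<in> Z'"
  shows "Z' = {mat c | c. c ^ CARD('n) = 1 \<and> L c = 0}"
proof -
  interpret S: group "SL :: ('a ^ 'n ^ 'n) monoid" by (rule group_SL)
  have nz: "c \<noteq> 0" if "c ^ CARD('n) = 1" for c :: 'a
    using that by (metis power_0_left zero_less_card_finite less_irrefl zero_neq_one)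
  have ker: "mat c \<in> Z'" if c: "c ^ CARD('n) = 1" "L c = 0" for c
  proof -
    obtain y where "c = y ^ r" using L(2)[OF nz[OF c(1)]] c(2) by blast
    then obtain b where b: "b ^ CARD('n) = 1" "c = b ^ r"
      using root_of_unity_power_root[OF r(1,3,2) c(1) _ nz[OF c(1)]] by metis
    then have "mat b [^]\<^bsub>SL\<^esub> r \<in> Z'" by (intro Z'(3)) (simp add: mat_in_group_center_SL)
    then show ?thesis by (simp add: pow_SL_mat b(2))
  qed
  have L_pow: "[L (c ^ m) = int m * L c] (mod int r)" if "c \<noteq> 0" for c m
  proof (induction m)
    case 0
    show ?case using L(2)[of 1] by (metis cong_refl mult_zero_left of_nat_0 power_0 power_one zero_neq_one)
  next
    case (Suc m)
    have "[L (c ^ Suc m) = L c + L (c ^ m)] (mod int r)" using L(1)[of c "c ^ m"] that by (simp add: cong_def)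
    also have "[L c + L (c ^ m) = L c + int m * L c] (mod int r)" using Suc by (intro cong_add cong_refl)
    finally show ?case by (simp add: algebra_simps)
  qed
  have "L z = 0" if z: "mat z \<in> Z'" "z ^ CARD('n) = 1" for z
  proof (rule ccontr)
    assume Lz: "L z \<noteq> 0"
    have "\<not> int r dvd L z" using Lz L(3)[of z] zdvd_not_zless[of "L z" "int r"] by auto
    then have cop: "coprime (L z) (int r)"
      using r(1) prime_imp_coprime[of "int r" "L z"] by (simp add: coprime_commute)
    have "group_center SL \<subseteq> Z'"
    proof
      fix w :: "'a ^ 'n ^ 'n" assume "w \<in> group_center SL"
      then obtain b where b: "w = mat b" "b ^ CARD('n) = 1" using center_SL_scalar by blast
      \<comment> \<open>The exponent is chosen so that b * z ^ t lies in the kernel of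
        \<open>L\<close>; \<open>m\<close> is its nonnegative representative modulo r.\<close>
      obtain t where t: "[L z * t = - L b] (mod int r)"
        using cong_solve_coprime_int[OF cop] by (metis cong_scalar_right mult.assoc mult_1)
      define m where "m = nat (t mod int r)"
      have "int m = t mod int r" using prime_gt_0_nat[OF r(1)] by (simp add: m_def)
      then have m: "[int m * L z = - L b] (mod int r)" using t by (simp add: cong_def mod_mult_right_eq mult.commute)
      have b0: "b \<noteq> 0" "z \<noteq> 0" using nz b(2) z(2) by auto
      have "[L (b * z ^ m) = L b + L (z ^ m)] (mod int r)" using L(1)[of b "z ^ m"] b0 by (simp add: cong_def)
      also have "[L b + L (z ^ m) = L b + - L b] (mod int r)"
        using cong_trans[OF L_pow[OF b0(2)] m] by (intro cong_add cong_refl)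
      finally have "L (b * z ^ m) = 0" using L(3)[of "b * z ^ m"] by (simp add: cong_def)
      moreover have "(b * z ^ m) ^ CARD('n) = 1"
        using b(2) z(2) by (simp add: power_mult_distrib) (metis power_mult mult.commute power_one)
      ultimately have 1: "mat (b * z ^ m) \<in> Z'" by (intro ker)
      have pow: "mat z [^]\<^bsub>SL\<^esub> m \<in> Z'" for m :: nat
        using subgroup.one_closed[OF Z'(1)] subgroup.m_closed[OF Z'(1) _ z(1)] by (induction m) simp_all
      have "inv\<^bsub>SL\<^esub> (mat z [^]\<^bsub>SL\<^esub> m) \<in> Z'"
        using subgroup.m_inv_closed[OF Z'(1) pow] .
      then have "mat (b * z ^ m) ** inv\<^bsub>SL\<^esub> (mat z [^]\<^bsub>SL\<^esub> m) \<in> Z'"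
        using subgroup.m_closed[OF Z'(1) 1] by simp
      moreover have "(mat (b * z ^ m) :: 'a ^ 'n ^ 'n) = mat b \<otimes>\<^bsub>SL\<^esub> (mat z [^]\<^bsub>SL\<^esub> m)"
        by (simp add: pow_SL_mat mat_mult_mat)
      moreover have "(mat b :: 'a ^ 'n ^ 'n) \<otimes>\<^bsub>SL\<^esub> (mat z [^]\<^bsub>SL\<^esub> m) \<otimes>\<^bsub>SL\<^esub> inv\<^bsub>SL\<^esub> (mat z [^]\<^bsub>SL\<^esub> m) = mat b"
      proof -
        have "(mat b :: 'a ^ 'n ^ 'n) \<in> carrier SL" "(mat z :: 'a ^ 'n ^ 'n) [^]\<^bsub>SL\<^esub> m \<in> carrier SL"
          using b(2) z(2) by (simp_all add: det_mat det_pow_SL)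
        then show ?thesis by (simp only: S.m_assoc S.inv_closed S.r_inv S.r_one)
      qed
      ultimately show "w \<in> Z'" by (simp add: b(1))
    qed
    then show False using Z'(2) by blast
  qed
  moreover have "\<exists>c. w = mat c \<and> c ^ CARD('n) = 1" if "w \<in> Z'" for w
    using that Z'(2) center_SL_scalar by (metis psubsetD)
  ultimately show ?thesis using ker by blast
qed

text \<open>The coefficient is taken at the preimage of x under \<open>A\<close>: the value at x of
  an element of the wreath product belongs to the basis vector that has been moved to x.\<close>

definition twisted_embedding ::
  "('a::field \<Rightarrow> int) \<Rightarrow> 'a ^ 'n ^ 'n \<Rightarrow> (('a ^ 'n) set \<Rightarrow> int) \<times> ('a ^ 'n ^ 'n) set" where
  "twisted_embedding L A =
     ((\<lambda>x\<in>proj_points. L (monomial_coeff A (proj_action (inv\<^bsub>PSL\<^esub> (group_center SL #>\<^bsub>SL\<^esub> A)) x))),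
      group_center SL #>\<^bsub>SL\<^esub> A)"

text \<open>For y the preimage of x under \<open>A\<close> and z the preimage of y under
  \<open>B\<close>, multiplicativity at x is \<open>L\<close> applied to the cocycle identity c(AB,
  z) = c(A, y) c(B, z).\<close>

lemma twisted_embedding_hom:
  fixes L :: "'a::{field, finite} \<Rightarrow> int" and r :: nat
  defines "W \<equiv> permutation_wreath_product (integer_mod_group r) (PSL :: ('a ^ 'n ^ 'n) set monoid) proj_points proj_action"
  assumes L: "\<And>x y. x \<noteq> 0 \<Longrightarrow> y \<noteq> 0 \<Longrightarrow> L (x * y) = (L x + L y) mod int r" "\<And>x. L x \<in> {0..<int r}"
    and r: "r > 0"
  shows "twisted_embedding L \<in> hom SL W"
proof (rule homI)
  let ?S = "SL :: ('a ^ 'n ^ 'n) monoid" and ?G = "PSL :: ('a ^ 'n ^ 'n) set monoid"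
  let ?p = "\<lambda>A. group_center ?S #>\<^bsub>?S\<^esub> A"
  interpret act: group_action ?G proj_points proj_action by (rule group_action_proj)
  interpret G: group ?G by (rule group_PSL)
  interpret p: group_hom ?S ?G ?p by (rule group_hom_SL_PSL)
  note [simp del] = SL_simps
  have Lc: "L x \<in> carrier (integer_mod_group r)" for x
    using L(2)[of x] r by (simp add: carrier_integer_mod_group)
  fix A assume A: "A \<in> carrier ?S"
  then show "twisted_embedding L A \<in> carrier W"
    by (auto simp: twisted_embedding_def W_def permutation_wreath_product_simps Lc)
  fix B assume B: "B \<in> carrier ?S"
  have det: "det A = 1" "det B = 1" using A B by (simp_all add: SL_simps)
  note pA = p.hom_closed[OF A] and pB = p.hom_closed[OF B]
  have "L (monomial_coeff (A \<otimes>\<^bsub>?S\<^esub> B) (proj_action (inv\<^bsub>?G\<^esub> ?p (A \<otimes>\<^bsub>?S\<^esub> B)) x))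
     = (L (monomial_coeff A (proj_action (inv\<^bsub>?G\<^esub> ?p A) x))
       + L (monomial_coeff B (proj_action (inv\<^bsub>?G\<^esub> ?p B) (proj_action (inv\<^bsub>?G\<^esub> ?p A) x)))) mod int r"
    if x: "x \<in> proj_points" for x
  proof -
    define y where "y = proj_action (inv\<^bsub>?G\<^esub> ?p A) x"
    define z where "z = proj_action (inv\<^bsub>?G\<^esub> ?p B) y"
    have y: "y \<in> proj_points" unfolding y_def using act.element_image[OF G.inv_closed[OF pA] x] by blast
    have z: "z \<in> proj_points" unfolding z_def using act.element_image[OF G.inv_closed[OF pB] y] by blast
    have "proj_action (inv\<^bsub>?G\<^esub> ?p (A \<otimes>\<^bsub>?S\<^esub> B)) x = z"
      using act.composition_rule[OF x G.inv_closed[OF pB] G.inv_closed[OF pA]]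
      by (simp add: p.hom_mult[OF A B] G.inv_mult_group[OF pA pB] y_def z_def)
    moreover have "(\<lambda>v. B *v v) ` z = y"
    proof -
      have "proj_action (?p B) z = y"
        using act.orbit_sym_aux[OF G.inv_closed[OF pB] y, of z] G.inv_inv[OF pB] by (simp add: z_def)
      then show ?thesis using proj_action_coset[OF det(2) z] by simp
    qed
    then have "monomial_coeff (A ** B) z = monomial_coeff A y * monomial_coeff B z"
      using monomial_coeff_mult[OF z det] by simp
    ultimately show ?thesis
      using L(1)[OF monomial_coeff(2)[OF y det(1)] monomial_coeff(2)[OF z det(2)]]
      by (simp add: SL_simps(2) y_def z_def)
  qed
  moreover have "proj_action (inv\<^bsub>?G\<^esub> ?p A) x \<in> proj_points" if "x \<in> proj_points" for x
    using act.element_image[OF G.inv_closed[OF pA] that] by blast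
  ultimately show "twisted_embedding L (A \<otimes>\<^bsub>?S\<^esub> B) = twisted_embedding L A \<otimes>\<^bsub>W\<^esub> twisted_embedding L B"
    unfolding twisted_embedding_def W_def permutation_wreath_product_simps
    by (auto intro!: restrict_ext simp: p.hom_mult[OF A B])
qed

lemma proj_points_nonempty: "(proj_points :: ('a::field ^ 'n) set set) \<noteq> {}"
proof -
  have "(1 :: 'a ^ 'n) \<noteq> 0" by (simp add: vec_eq_iff)
  then have "vec.span {1 :: 'a ^ 'n} \<in> proj_points" unfolding proj_points_iff by blast
  then show ?thesis by blast
qed

text \<open>Triviality of the permutation part means that the matrix is a central scalar c. Its
  first component is then constantly \<open>L c\<close>, and since there is at least one point, this
  is trivial only if \<open>L c = 0\<close>.\<close>

lemma twisted_embedding_kernel: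
  fixes L :: "'a::{field, finite} \<Rightarrow> int" and r :: nat
  defines "W \<equiv> permutation_wreath_product (integer_mod_group r) (PSL :: ('a ^ 'n ^ 'n) set monoid) proj_points proj_action"
  shows "kernel SL W (twisted_embedding L) = {mat c | c. c ^ CARD('n) = 1 \<and> L c = 0}"
proof -
  let ?S = "SL :: ('a ^ 'n ^ 'n) monoid" and ?G = "PSL :: ('a ^ 'n ^ 'n) set monoid"
  interpret act: group_action ?G proj_points proj_action by (rule group_action_proj)
  interpret G: group ?G by (rule group_PSL)
  have main: "twisted_embedding L (mat c :: 'a ^ 'n ^ 'n) = \<one>\<^bsub>W\<^esub> \<longleftrightarrow> L c = 0" if c: "c ^ CARD('n) = 1" for c
  proof -
    have one: "group_center ?S #>\<^bsub>?S\<^esub> mat c = \<one>\<^bsub>?G\<^esub>"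
      using c coset_center_SL_eq_one_iff[of "mat c :: 'a ^ 'n ^ 'n"] by (simp add: det_mat mat_in_group_center_SL)
    have "proj_action (inv\<^bsub>?G\<^esub> \<one>\<^bsub>?G\<^esub>) x = x" if "x \<in> proj_points" for x
      using fun_cong[OF act.id_eq_one, of x] that by simp
    then have "twisted_embedding L (mat c :: 'a ^ 'n ^ 'n) = ((\<lambda>x\<in>proj_points. L c), \<one>\<^bsub>?G\<^esub>)"
      unfolding twisted_embedding_def one using c by (auto intro!: restrict_ext simp: monomial_coeff_mat)
    moreover have "(\<lambda>x\<in>(proj_points :: ('a ^ 'n) set set). L c) = (\<lambda>x\<in>proj_points. 0) \<longleftrightarrow> L c = 0"
    proof
      assume eq: "(\<lambda>x\<in>(proj_points :: ('a ^ 'n) set set). L c) = (\<lambda>x\<in>proj_points. 0)"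
      obtain x :: "('a ^ 'n) set" where "x \<in> proj_points" using proj_points_nonempty by blast
      then show "L c = 0" using fun_cong[OF eq, of x] by simp
    qed simp
    ultimately show ?thesis by (simp add: W_def permutation_wreath_product_simps)
  qed
  have center: "\<exists>c. A = mat c \<and> c ^ CARD('n) = 1" if "det A = 1" "twisted_embedding L A = \<one>\<^bsub>W\<^esub>" for A :: "'a ^ 'n ^ 'n"
  proof -
    have "group_center ?S #>\<^bsub>?S\<^esub> A = \<one>\<^bsub>?G\<^esub>"
      using that(2) by (simp add: twisted_embedding_def W_def permutation_wreath_product_simps)
    then have "A \<in> group_center SL" using coset_center_SL_eq_one_iff[OF that(1)] by blast
    then show ?thesis using center_SL_scalar by metis
  qed
  show ?thesis
  proof (intro subset_antisym subsetI)
    fix A assume "A \<in> kernel SL W (twisted_embedding L)"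
    then have A: "det A = 1" "twisted_embedding L A = \<one>\<^bsub>W\<^esub>" by (auto simp: kernel_def)
    with center obtain c where "A = mat c" "c ^ CARD('n) = 1" by blast
    then show "A \<in> {mat c | c. c ^ CARD('n) = 1 \<and> L c = 0}" using main A(2) by blast
  next
    fix A :: "'a ^ 'n ^ 'n" assume "A \<in> {mat c | c. c ^ CARD('n) = 1 \<and> L c = 0}"
    then obtain c where "A = mat c" "c ^ CARD('n) = 1" "L c = 0" by blast
    then show "A \<in> kernel SL W (twisted_embedding L)" using main by (simp add: kernel_def det_mat)
  qed
qed

lemma hom_of_quotient_embedding:
  assumes "group S" "N \<lhd> S" "subgroup H W" "group W" "S Mod N \<cong> W\<lparr>carrier := H\<rparr>"
  obtains \<phi> where "\<phi> \<in> hom S W" "kernel S W \<phi> = N"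
proof -
  interpret N: normal N S by fact
  obtain \<psi> where \<psi>: "\<psi> \<in> iso (S Mod N) (W\<lparr>carrier := H\<rparr>)" using assms(5) by (auto simp: is_iso_def)
  interpret Q: group "S Mod N" by (rule N.factorgroup_is_group)
  have gH: "group (W\<lparr>carrier := H\<rparr>)" by (rule subgroup.subgroup_is_group[OF assms(3,4)])
  interpret \<psi>: group_hom "S Mod N" "W\<lparr>carrier := H\<rparr>" \<psi>
    using \<psi> Q.is_group gH by (auto simp: group_hom_def group_hom_axioms_def iso_def)
  have "\<psi> \<in> hom (S Mod N) W"
    using \<psi>.homh subgroup.subset[OF assms(3)] by (auto simp: hom_def)
  then have "\<psi> \<circ> (\<lambda>x. N #>\<^bsub>S\<^esub> x) \<in> hom S W" using hom_compose[OF N.r_coset_hom_Mod] by blast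
  moreover have "kernel S W (\<psi> \<circ> (\<lambda>x. N #>\<^bsub>S\<^esub> x)) = N"
  proof -
    have "\<psi> (N #>\<^bsub>S\<^esub> x) = \<one>\<^bsub>W\<^esub> \<longleftrightarrow> x \<in> N" if x: "x \<in> carrier S" for x
    proof -
      have "N #>\<^bsub>S\<^esub> x \<in> carrier (S Mod N)" using x by (auto simp: carrier_FactGroup)
      moreover have "inj_on \<psi> (carrier (S Mod N))" using \<psi> by (simp add: iso_def bij_betw_def)
      ultimately have "\<psi> (N #>\<^bsub>S\<^esub> x) = \<one>\<^bsub>W\<^esub> \<longleftrightarrow> N #>\<^bsub>S\<^esub> x = N"
        using \<psi>.inj_on_one_iff \<psi>.hom_one by (auto simp: FactGroup_def)
      also have "\<dots> \<longleftrightarrow> x \<in> N"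
        using N.coset_join1[OF _ x N.subgroup_axioms] N.coset_join2[OF x N.subgroup_axioms] N.subset by blast
      finally show ?thesis .
    qed
    then show ?thesis using N.subset by (auto simp: kernel_def)
  qed
  ultimately show thesis by (rule that)
qed

section \<open>Dimension two, and the equivalence\<close>

lemma card_center_SL_le_2:
  assumes "CARD('n) = 2"
  shows "card (group_center (SL :: ('a::field ^ 'n ^ 'n) monoid)) \<le> 2"
proof -
  have "group_center (SL :: ('a ^ 'n ^ 'n) monoid) \<subseteq> {mat 1, mat (-1)}"
  proof
    fix z :: "'a ^ 'n ^ 'n" assume "z \<in> group_center SL"
    then obtain c where c: "z = mat c" "c ^ CARD('n) = 1" using center_SL_scalar by blast
    then have "c = 1 \<or> c = -1" using assms by (simp add: power2_eq_1_iff)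
    then show "z \<in> {mat 1, mat (-1)}" using c(1) by blast
  qed
  then have "card (group_center (SL :: ('a ^ 'n ^ 'n) monoid)) \<le> card {mat 1, mat (-1) :: 'a ^ 'n ^ 'n}"
    by (intro card_mono) auto
  also have "\<dots> \<le> 2" by (simp add: card_insert_if)
  finally show ?thesis .
qed

theorem theorem2:
  fixes n q r :: nat
    and G :: "('a::{field, finite} ^ 'n ^ 'n) set monoid"
    and Z' :: "('a ^ 'n ^ 'n) set"
    and W :: "((('a ^ 'n) set \<Rightarrow> int) \<times> ('a ^ 'n ^ 'n) set) monoid"
  assumes "CARD('n) = n" and "CARD('a) = q"
    and "G = PSL"
    and "prime r" and "r dvd gcd n (q - 1)"
    and "subgroup Z' (SL\<lparr>carrier := group_center SL\<rparr>)"
    and "card (rcosets\<^bsub>SL\<lparr>carrier := group_center SL\<rparr>\<^esub> Z') = r"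
    and "W = permutation_wreath_product (integer_mod_group r) G proj_points proj_action"
  shows "(\<exists>H. subgroup H W \<and>
              nonsplit_central_extension r (W\<lparr>carrier := H\<rparr>) G \<and>
              SL Mod Z' \<cong> W\<lparr>carrier := H\<rparr>)
         \<longleftrightarrow> \<not> r dvd (q - 1) div gcd n (q - 1)"
proof -
  let ?S = "SL :: ('a ^ 'n ^ 'n) monoid"
  have W: "W = permutation_wreath_product (integer_mod_group r) PSL proj_points proj_action"
    using assms(3,8) by simp
  interpret S: group ?S by (rule group_SL)
  note Z' = S.central_index_prime[OF assms(6,4,7)]
  have rn: "r dvd n" and rq: "r dvd CARD('a) - 1" using assms(2,5) by auto
  have ns: "nonsplit_central_extension r (SL Mod Z') G"
    unfolding assms(3) using assms(1,2,5) by (intro SL_Mod_nonsplit_central_extension assms(4,6,7)) simp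
  have Zn: "Z' \<lhd> ?S" using S.normal_of_le_center[OF Z'(2)] Z'(1) by blast
  have gW: "group W" unfolding W by (rule group_permutation_wreath_product) (simp_all add: group_action_proj)
  show ?thesis
  proof
    assume "\<exists>H. subgroup H W \<and> nonsplit_central_extension r (W\<lparr>carrier := H\<rparr>) G \<and> SL Mod Z' \<cong> W\<lparr>carrier := H\<rparr>"
    then obtain \<phi> where \<phi>: "\<phi> \<in> hom SL W" "kernel SL W \<phi> = Z'"
      using hom_of_quotient_embedding[OF group_SL Zn _ gW] by blast
    have "3 \<le> CARD('n) \<or> r = 2 \<and> Z' = {mat 1}"
    proof (cases "3 \<le> CARD('n)")
      \<comment> \<open>Since r divides n, dimension 1 is impossible, so n = r = 2. The center has
        at most two elements and Z' has index 2 in it, hence is trivial.\<close>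
      case False
      have "n > 0" using assms(1) by auto
      then have "r = 2" "CARD('n) = 2"
        using False rn prime_ge_2_nat[OF assms(4)] dvd_imp_le[OF rn] assms(1) by auto
      then have "card Z' \<le> 1" using Z'(3) card_center_SL_le_2[where 'n = 'n and 'a = 'a] by simp
      moreover have "mat 1 \<in> Z'" using subgroup.one_closed[OF Z'(2)] by simp
      ultimately have "Z' = {mat 1}" using card_le_Suc0_iff_eq[of Z'] by auto
      then show ?thesis using \<open>r = 2\<close> by simp
    qed simp
    then show "\<not> r dvd (q - 1) div gcd n (q - 1)"
      using no_embedding_of_quotient[OF \<phi>[unfolded W] assms(4) _ Z'(1)] assms(1,2) by auto
  next
    assume nr: "\<not> r dvd (q - 1) div gcd n (q - 1)"
    obtain L :: "'a \<Rightarrow> int" where L: "\<And>x. L x \<in> {0..<int r}"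
      "\<And>x y. x \<noteq> 0 \<Longrightarrow> y \<noteq> 0 \<Longrightarrow> L (x * y) = (L x + L y) mod int r"
      "\<And>x. x \<noteq> 0 \<Longrightarrow> L x = 0 \<longleftrightarrow> (\<exists>y. y \<noteq> 0 \<and> x = y ^ r)"
      by (rule residue_character[OF rq prime_gt_0_nat[OF assms(4)]]) blast
    define \<phi> :: "'a ^ 'n ^ 'n \<Rightarrow> _" where "\<phi> = twisted_embedding L"
    have hom: "\<phi> \<in> hom ?S W"
      unfolding \<phi>_def W by (rule twisted_embedding_hom[OF L(2,1) prime_gt_0_nat[OF assms(4)]])
    have "Z' = {mat c | c. c ^ CARD('n) = 1 \<and> L c = 0}"
      using nr assms(1,2) by (intro subgroup_center_SL_eq[OF assms(4) rq _ L(2,3,1) Z'(2,1,4)]) auto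
    then have ker: "kernel ?S W \<phi> = Z'" unfolding \<phi>_def W twisted_embedding_kernel by simp
    interpret \<phi>: group_hom ?S W \<phi>
      using hom gW group_SL by (simp add: group_hom_def group_hom_axioms_def)
    define H where "H = \<phi> ` carrier ?S"
    have H: "subgroup H W" unfolding H_def by (rule \<phi>.img_is_subgroup)
    have gH: "group (W\<lparr>carrier := H\<rparr>)" by (rule subgroup.subgroup_is_group[OF H gW])
    have "\<phi> \<in> hom ?S (W\<lparr>carrier := H\<rparr>)" using hom by (auto simp: hom_def H_def)
    then interpret h: group_hom ?S "W\<lparr>carrier := H\<rparr>" \<phi>
      using gH group_SL by (simp add: group_hom_def group_hom_axioms_def)
    have "kernel ?S (W\<lparr>carrier := H\<rparr>) \<phi> = Z'" using ker by (simp add: kernel_def)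
    \<comment> \<open>First isomorphism theorem for \<open>\<phi>\<close> onto its image. The
      nonsplit extension structure is carried to \<open>H\<close> along this map.\<close>
    then have iso: "(\<lambda>X. the_elem (\<phi> ` X)) \<in> iso (SL Mod Z') (W\<lparr>carrier := H\<rparr>)"
      using h.FactGroup_iso_set by (simp add: H_def)
    then have "SL Mod Z' \<cong> W\<lparr>carrier := H\<rparr>" by (auto simp: is_iso_def)
    moreover have "nonsplit_central_extension r (W\<lparr>carrier := H\<rparr>) G"
      by (rule nonsplit_central_extension_iso[OF ns iso gH])
    ultimately show "\<exists>H. subgroup H W \<and> nonsplit_central_extension r (W\<lparr>carrier := H\<rparr>) G \<and> SL Mod Z' \<cong> W\<lparr>carrier := H\<rparr>"
      using H by blast
  qed
qed

end
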